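(* Let $\Omega=\mathbb{R}^3\setminus B_1(0)$ and $\varphi_b\equiv0$. Then there is a radially symmetric $\varphi\in L^\infty(\Omega)$ such that for every $r>1$ there is $\tau_2>0$ such that for every compact set $K\subset(\mathbb{R}^3\setminus B_r(0))\times(0,\tau_2)$ there are $C>0$ and $\varepsilon_0\in(0,1/\sqrt{\pi}]$ such that the radially symmetric global-in-time solution $u_\varepsilon=v_\varepsilon+w_\varepsilon$ (see context) with data $\varphi$ and $\varphi_b\equiv0$ satisfies $$u_\varepsilon(x,t)-[S_2(t)\varphi_b](x)=u_\varepsilon(x,t)\ge C\sqrt{\varepsilon}$$ for every $\varepsilon\in(0,\varepsilon_0)$ and every $(x,t)\in K$.
   Context: Setting: $B_r(0)=\{x\in\mathbb{R}^3: |x|<r\}$, $\Omega=\mathbb{R}^3\setminus B_1(0)$. Functions are radially symmetric in $x$ and written as functions of $r=|x|$; a radially symmetric element of $L^\infty(\partial\Omega)$ is identified with a real number. $\partial_\nu=-\partial_r$ on all of $\overline\Omega$. The problem is $$\varepsilon\partial_tu_\varepsilon-\Delta u_\varepsilon=0\ \text{in }\Omega\times(0,\infty),\quad \partial_tu_\varepsilon+\partial_\nu u_\varepsilon=0\ \text{on }\partial\Omega\times(0,\infty),\quad u_\varepsilon(\cdot,0)=\varphi\ \text{in }\Omega,\quad u_\varepsilon(\cdot,0)=\varphi_b\ \text{on }\partial\Omega.$$ Dirichlet heat semigroup on $\Omega$ for radially symmetric $\phi$: $$[S_1(t)\phi](r)=\frac{1}{r\sqrt{4\pi t}}\int_1^\infty\Big(e^{-\frac{(r-\rho)^2}{4t}}-e^{-\frac{(r+\rho-2)^2}{4t}}\Big)\rho\,\phi(\rho)\,d\rho,\qquad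 r>1,\ t>0.$$ For $\psi\in\mathbb{R}$, $[S_2(t)\psi](r)=\dfrac{\psi}{re^t}$, $r\ge1$, $t\ge0$. Solution: put $\Phi=\varphi-S_2(0)\varphi_b$. A pair $(v_\varepsilon,w_\varepsilon)$ with $v_\varepsilon,\partial_\nu v_\varepsilon,w_\varepsilon\in C(\overline\Omega\times(0,\infty))$ is a global-in-time solution if for $x\in\Omega$, $t>0$ $$w_\varepsilon(x,t)=[S_2(t)\varphi_b](x)-\int_0^t[S_2(t-s)\,\partial_\nu v_\varepsilon|_{\partial\Omega}(\cdot,s)](x)\,ds,$$ $$v_\varepsilon(x,t)=[S_1(t/\varepsilon)\Phi](x)-\int_0^t[S_1((t-s)/\varepsilon)\,\partial_tw_\varepsilon(\cdot,s)](x)\,ds,$$ where $\partial_tw_\varepsilon=F_1[\varphi_b]+F_2[v_\varepsilon]$ with $F_1[\varphi_b](x,t)=\partial_t[S_2(t)\varphi_b](x)$ and $$F_2[v](x,t)=-[S_2(0)\,\partial_\nu v|_{\partial\Omega}(\cdot,t)](x)-\int_0^t\partial_t[S_2(t-s)\,\partial_\nu v|_{\partial\Omega}(\cdot,s)](x)\,ds.$$ For every $\varepsilon\in(0,1/\sqrt{\pi})$ and radially symmetric bounded data there is a unique radially symmetric global-in-time solution with $\sup_{0<t<T}\big(\|v_\varepsilon(\cdot,t)\|_{L^\infty(\Omega)}+\sqrt{t/\varepsilon}\,\|\partial_\nu v_\varepsilon(\cdot,t)\|_{L^\infty(\Omega)}+\|w_\varepsilon(\cdot,t)\|_{L^\infty(\Omega)}\big)<\infty$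 for every $T>0$; $u_\varepsilon:=v_\varepsilon+w_\varepsilon$ is built from it. *)

theory Defs
  imports "HOL-Analysis.Analysis" "HOL-Probability.Essential_Supremum"
begin

text \<open>
  The exterior of the open unit ball. As a set it is closed and contains its boundary, the unit
  sphere, so it also plays the role of its own closure.
\<close>
definition Omega :: "(real ^ 3) set" where
  "Omega = UNIV - ball 0 1"

definition radial :: "(real ^ 3 \<Rightarrow> real) \<Rightarrow> bool" where
  "radial f \<longleftrightarrow> (\<forall>x\<in>Omega. \<forall>y\<in>Omega. norm x = norm y \<longrightarrow> f x = f y)"

text \<open>
  A radial function \<open>f\<close> written as a function of \<open>\<rho> = \<bar>x\<bar> \<ge> 1\<close>; by radial symmetry the
  direction used here is irrelevant.
\<close>
definition profile :: "(real ^ 3 \<Rightarrow> real) \<Rightarrow> real \<Rightarrow> real" where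
  "profile f \<rho> = f (\<rho> *\<^sub>R axis 1 1)"

text \<open>The norm of \<open>L\<^sup>\<infinity>(\<Omega>)\<close>; it is infinite if \<open>f\<close> is not measurable on \<open>Omega\<close>.\<close>
definition Linf_norm :: "(real ^ 3 \<Rightarrow> real) \<Rightarrow> ennreal" where
  "Linf_norm f = esssup (lebesgue_on Omega) (\<lambda>x. ennreal \<bar>f x\<bar>)"

definition Linf :: "(real ^ 3 \<Rightarrow> real) set" where
  "Linf = {f. f \<in> borel_measurable (lebesgue_on Omega) \<and> Linf_norm f < \<infinity>}"

text \<open>
  The derivative \<open>-\<partial>\<^sub>r\<close> at \<open>x \<in> Omega\<close>, taken along the ray through \<open>x\<close>; it is one-sided on the
  unit sphere, since the ray is restricted to \<open>Omega\<close>.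
\<close>
definition normal_deriv :: "(real ^ 3 \<Rightarrow> real) \<Rightarrow> real ^ 3 \<Rightarrow> real" where
  "normal_deriv f x = - vector_derivative (\<lambda>\<rho>. f (\<rho> *\<^sub>R sgn x)) (at (norm x) within {1..})"

definition normal_differentiable :: "(real ^ 3 \<Rightarrow> real) \<Rightarrow> real ^ 3 \<Rightarrow> bool" where
  "normal_differentiable f x \<longleftrightarrow>
     (\<lambda>\<rho>. f (\<rho> *\<^sub>R sgn x)) differentiable (at (norm x) within {1..})"

text \<open>
  The Dirichlet heat semigroup on \<open>Omega\<close> for radial \<open>\<phi>\<close> and \<open>t > 0\<close>. For \<open>norm x = 1\<close> the kernel
  vanishes, so that the formula also covers the boundary. The integral is taken with respect to the
  completed measure because \<open>\<phi>\<close> is only assumed to be Lebesgue measurable.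
\<close>
definition S1 :: "real \<Rightarrow> (real ^ 3 \<Rightarrow> real) \<Rightarrow> real ^ 3 \<Rightarrow> real" where
  "S1 t \<phi> x = 1 / (norm x * sqrt (4 * pi * t)) *
     (LINT \<rho>:{1..}|lebesgue.
        (exp (- (norm x - \<rho>)\<^sup>2 / (4 * t)) - exp (- (norm x + \<rho> - 2)\<^sup>2 / (4 * t))) * \<rho> * profile \<phi> \<rho>)"

text \<open>Radial boundary data on the unit sphere are real numbers.\<close>
definition S2 :: "real \<Rightarrow> real \<Rightarrow> real ^ 3 \<Rightarrow> real" where
  "S2 t \<psi> x = \<psi> / (norm x * exp t)"

text \<open>The restriction of \<open>\<partial>\<^sub>\<nu> v(\<cdot>,t)\<close> to the unit sphere, for radial \<open>v(\<cdot>,t)\<close>, as a real number.\<close>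
definition normal_trace :: "(real ^ 3 \<Rightarrow> real \<Rightarrow> real) \<Rightarrow> real \<Rightarrow> real" where
  "normal_trace v t = profile (normal_deriv (\<lambda>x. v x t)) 1"

definition F1 :: "real \<Rightarrow> real ^ 3 \<Rightarrow> real \<Rightarrow> real" where
  "F1 \<phi>b x t = deriv (\<lambda>\<tau>. S2 \<tau> \<phi>b x) t"

definition F2 :: "(real ^ 3 \<Rightarrow> real \<Rightarrow> real) \<Rightarrow> real ^ 3 \<Rightarrow> real \<Rightarrow> real" where
  "F2 v x t = - S2 0 (normal_trace v t) x
     - (LINT s:{0..t}|lebesgue. deriv (\<lambda>\<tau>. S2 (\<tau> - s) (normal_trace v s) x) t)"

definition w_equation ::
  "real \<Rightarrow> (real ^ 3 \<Rightarrow> real \<Rightarrow> real) \<Rightarrow> (real ^ 3 \<Rightarrow> real \<Rightarrow> real) \<Rightarrow> bool" where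
  "w_equation \<phi>b v w \<longleftrightarrow> (\<forall>x\<in>Omega. \<forall>t>0.
     w x t = S2 t \<phi>b x - (LINT s:{0..t}|lebesgue. S2 (t - s) (normal_trace v s) x))"

definition v_equation ::
  "real \<Rightarrow> (real ^ 3 \<Rightarrow> real) \<Rightarrow> real \<Rightarrow> (real ^ 3 \<Rightarrow> real \<Rightarrow> real) \<Rightarrow> bool" where
  "v_equation \<epsilon> \<phi> \<phi>b v \<longleftrightarrow> (\<forall>x\<in>Omega. \<forall>t>0.
     v x t = S1 (t / \<epsilon>) (\<lambda>y. \<phi> y - S2 0 \<phi>b y) x
       - (LINT s:{0..t}|lebesgue. S1 ((t - s) / \<epsilon>) (\<lambda>y. F1 \<phi>b y s + F2 v y s) x))"

definition global_solution ::
  "real \<Rightarrow> (real ^ 3 \<Rightarrow> real) \<Rightarrow> real \<Rightarrow> (real ^ 3 \<Rightarrow> real \<Rightarrow> real) \<Rightarrow> (real ^ 3 \<Rightarrow> real \<Rightarrow> real) \<Rightarrow> bool" where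
  "global_solution \<epsilon> \<phi> \<phi>b v w \<longleftrightarrow>
     continuous_on (Omega \<times> {0<..}) (\<lambda>(x, t). v x t) \<and>
     (\<forall>x\<in>Omega. \<forall>t>0. normal_differentiable (\<lambda>y. v y t) x) \<and>
     continuous_on (Omega \<times> {0<..}) (\<lambda>(x, t). normal_deriv (\<lambda>y. v y t) x) \<and>
     continuous_on (Omega \<times> {0<..}) (\<lambda>(x, t). w x t) \<and>
     w_equation \<phi>b v w \<and> v_equation \<epsilon> \<phi> \<phi>b v"

text \<open>
  The solution class in which radial bounded data admit exactly one solution (as functions on
  \<open>Omega \<times> {0<..}\<close>; values elsewhere are not constrained).
\<close>
definition radial_global_solution ::
  "real \<Rightarrow> (real ^ 3 \<Rightarrow> real) \<Rightarrow> real \<Rightarrow> (real ^ 3 \<Rightarrow> real \<Rightarrow> real) \<Rightarrow> (real ^ 3 \<Rightarrow> real \<Rightarrow> real) \<Rightarrow> bool" where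
  "radial_global_solution \<epsilon> \<phi> \<phi>b v w \<longleftrightarrow>
     global_solution \<epsilon> \<phi> \<phi>b v w \<and>
     (\<forall>t>0. radial (\<lambda>x. v x t) \<and> radial (\<lambda>x. w x t)) \<and>
     (\<forall>T>0. (SUP t\<in>{0<..<T}.
        Linf_norm (\<lambda>x. v x t)
        + ennreal (sqrt (t / \<epsilon>)) * Linf_norm (normal_deriv (\<lambda>x. v x t))
        + Linf_norm (\<lambda>x. w x t)) < \<infinity>)"

end

theory Submission
  imports Defs "HOL-Probability.Distributions"
begin

text \<open>
  Take \<open>\<phi> x = 1 - 1 / \<bar>x\<bar>\<close>, which the Dirichlet heat semigroup leaves fixed for every value of
  \<open>\<epsilon>\<close>. With \<open>y = \<bar>x\<bar> - 1\<close>, \<open>g = \<partial>\<^sub>\<nu> v\<close> on the unit sphere, \<open>q(t) = \<integral>\<^sub>0\<^sup>t e\<^bsup>s - t\<^esup> g(s) ds\<close> and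
  \<open>h = g - q = q'\<close>, the integral equations become
  \<open>\<bar>x\<bar> v = y + \<integral>\<^sub>0\<^sup>t h(s) erf (y / (2 \<surd>((t - s) / \<epsilon>))) ds\<close> and \<open>\<bar>x\<bar> w = - q(t)\<close>.

  Lower bound: the bound \<open>\<bar>erf z\<bar> \<le> 2 z / \<surd>\<pi>\<close> makes the integral \<open>O(y \<surd>\<epsilon>)\<close> sup \<open>\<surd>s \<bar>g(s)\<bar>\<close>. Dividing
  by \<open>y\<close> and letting \<open>y \<rightarrow> 0\<close> bounds \<open>g\<close> by itself with a small factor, so that \<open>\<surd>s \<bar>g(s)\<bar> \<le> 2\<close> on
  \<open>(0,1)\<close> for small \<open>\<epsilon>\<close>. Hence \<open>\<bar>x\<bar> (v + w) \<ge> y / 2 - 4 \<surd>t\<close>, which is even bounded below by a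
  positive constant for \<open>\<bar>x\<bar> \<ge> r\<close> and \<open>t\<close> small depending on \<open>r\<close>.

  Existence: the equation for \<open>h\<close> is the Volterra equation
  \<open>h(t) = - 1 - \<integral>\<^sub>0\<^sup>t h(s) (1 + \<surd>(\<epsilon> / \<pi>) / \<surd>(t - s)) ds\<close>, solved by a fixed point argument in an
  exponentially weighted space of continuous functions.
\<close>

section \<open>The Dirichlet heat semigroup on two explicit data\<close>

definition erf :: "real \<Rightarrow> real" where
  "erf x = 2 / sqrt pi * (LBINT z=0..x. exp (- z\<^sup>2))"

lemma erf_0 [simp]: "erf 0 = 0"
  by (simp add: erf_def zero_ereal_def)

lemma DERIV_erf: "(erf has_real_derivative 2 / sqrt pi * exp (- x\<^sup>2)) (at x)"
proof -
  \<comment> \<open>The interval \<open>{-b..b}\<close> contains both the base point 0 and, in its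
    interior, \<open>x\<close>. The fundamental theorem therefore applies from 0, and the derivative
    within the interval becomes two-sided.\<close>
  define b where "b = \<bar>x\<bar> + 1"
  have x: "x \<in> {-b<..<b}" by (auto simp: b_def)
  have cont: "continuous_on {-b..b} (\<lambda>z. exp (- z\<^sup>2))"
    by (intro continuous_intros)
  have "((\<lambda>u. LBINT z=0..u. exp (- z\<^sup>2)) has_vector_derivative exp (- x\<^sup>2)) (at x within {-b..b})"
    unfolding zero_ereal_def
    by (rule interval_integral_FTC2[OF _ _ cont]) (use x in \<open>simp_all add: b_def\<close>)
  then have "((\<lambda>u. LBINT z=0..u. exp (- z\<^sup>2)) has_vector_derivative exp (- x\<^sup>2)) (at x within {-b<..<b})"
    by (rule has_vector_derivative_within_subset) auto
  then have "((\<lambda>u. LBINT z=0..u. exp (- z\<^sup>2)) has_real_derivative exp (- x\<^sup>2)) (at x)"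
    using x at_within_open[OF x open_greaterThanLessThan]
    by (simp only: has_real_derivative_iff_has_vector_derivative)
  from DERIV_cmult[OF this, of "2 / sqrt pi"] show ?thesis
    by (simp add: erf_def [abs_def])
qed

lemmas DERIV_erf' [derivative_intros] = DERIV_erf[THEN DERIV_chain2]

lemma continuous_on_erf [continuous_intros]:
  "continuous_on S f \<Longrightarrow> continuous_on S (\<lambda>x. erf (f x))"
  using DERIV_continuous_on[OF DERIV_subset[OF DERIV_erf]] continuous_on_compose2[of UNIV erf S f]
  by blast

lemma borel_measurable_erf [measurable]: "erf \<in> borel_measurable borel"
  by (intro borel_measurable_continuous_onI continuous_intros)

lemma erf_minus: "erf (- x) = - erf x"
proof -
  have "((\<lambda>x. erf x + erf (- x)) has_real_derivative 0) (at u)" for u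
    by (auto intro!: derivative_eq_intros)
  then have "erf x + erf (- x) = erf 0 + erf (- 0)"
    using DERIV_isconst_all[of "\<lambda>x. erf x + erf (- x)" x 0] by blast
  then show ?thesis by simp
qed

lemma erf_lipschitz: "\<bar>erf x - erf y\<bar> \<le> 2 / sqrt pi * \<bar>x - y\<bar>"
proof -
  have "norm (erf x - erf y) \<le> 2 / sqrt pi * norm (x - y)"
    by (rule field_differentiable_bound[OF convex_UNIV DERIV_erf]) (auto simp: abs_mult field_simps)
  then show ?thesis by simp
qed

text \<open>At the argument \<open>y / (2 * sqrt ((t - s) / \<epsilon>))\<close> this linear bound
  produces the factor \<open>y * sqrt \<epsilon>\<close> on which the smallness argument rests, at
  the price of an integrable singularity at \<open>s = t\<close>.\<close>

lemma abs_erf_le: "\<bar>erf x\<bar> \<le> 2 / sqrt pi * \<bar>x\<bar>"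
  using erf_lipschitz[of x 0] by simp

text \<open>Reflection at the boundary: the Dirichlet flow is the Gaussian flow of the odd extension.\<close>
lemma S1_odd_extension:
  assumes t: "t > 0"
    and odd: "\<And>\<eta>. \<psi> (- \<eta>) = - \<psi> \<eta>"
    and int: "integrable lborel (\<lambda>\<eta>. normal_density (norm x - 1) (sqrt (2 * t)) \<eta> * \<psi> \<eta>)"
    and [measurable]: "\<psi> \<in> borel_measurable borel"
    and \<phi>: "\<And>\<rho>. \<rho> > 1 \<Longrightarrow> \<rho> * profile \<phi> \<rho> = \<psi> (\<rho> - 1)"
  shows "S1 t \<phi> x =
    (LINT \<eta>|lborel. normal_density (norm x - 1) (sqrt (2 * t)) \<eta> * \<psi> \<eta>) / norm x"
proof -
  define N where "N = normal_density (norm x - 1) (sqrt (2 * t))"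
  have [measurable]: "N \<in> borel_measurable borel" by (simp add: N_def)
  define F where "F \<eta> = N \<eta> * \<psi> \<eta>" for \<eta>
  have intF: "integrable lborel F" using int by (simp add: F_def[abs_def] N_def)
  have intF': "integrable lborel (\<lambda>\<eta>. F (- \<eta>))"
    using lborel_integrable_real_affine[OF intF, of "-1" 0] by simp
  have ind: "integrable lborel (\<lambda>\<eta>. indicator A \<eta> * G \<eta>)"
    if "integrable lborel G" "A \<in> sets borel" for A and G :: "real \<Rightarrow> real"
    using integrable_mult_indicator[of A lborel G] that by simp
  have N: "N \<eta> = exp (- (\<eta> - (norm x - 1))\<^sup>2 / (4 * t)) / sqrt (4 * pi * t)" for \<eta>
    using t by (simp add: N_def normal_density_def field_simps)
  have [simp]: "\<psi> 0 = 0" using odd[of 0] by simp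
  \<comment> \<open>With \<open>\<eta> = \<rho> - 1\<close>, the two exponentials are the Gaussian
    centred at \<open>norm x - 1\<close>, evaluated at \<open>\<eta>\<close> and
    \<open>- \<eta>\<close>. Oddness of \<open>\<psi>\<close> turns their difference into a sum of
    two values of \<open>F\<close>.\<close>
  have E: "(exp (- (norm x - \<rho>)\<^sup>2 / (4 * t)) - exp (- (norm x + \<rho> - 2)\<^sup>2 / (4 * t))) * \<rho> * profile \<phi> \<rho>
      = sqrt (4 * pi * t) * (F (\<rho> - 1) + F (- (\<rho> - 1)))" if "\<rho> \<ge> 1" for \<rho>
  \<comment> \<open>The assumption on \<open>\<phi>\<close> says nothing at
    \<open>\<rho> = 1\<close>; there the two exponentials cancel and
    \<open>\<psi> 0 = 0\<close>.\<close>
  proof (cases "\<rho> = 1")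
    case True
    then show ?thesis by (simp add: F_def)
  next
    case False
    have e1: "(\<rho> - 1 - (norm x - 1))\<^sup>2 = (norm x - \<rho>)\<^sup>2" by (simp add: power2_commute)
    have e2: "(- (\<rho> - 1) - (norm x - 1))\<^sup>2 = (norm x + \<rho> - 2)\<^sup>2"
      by (simp add: power2_eq_square algebra_simps)
    have e3: "\<rho> * profile \<phi> \<rho> = \<psi> (\<rho> - 1)" using False that by (intro \<phi>) auto
    define k where "k = sqrt (4 * pi * t)"
    have "k > 0" using t by (simp add: k_def)
    then show ?thesis
      unfolding F_def odd mult.assoc e3 N e1 e2 k_def[symmetric] by (simp add: field_simps)
  qed
  have "(LINT \<rho>:{1..}|lebesgue. (exp (- (norm x - \<rho>)\<^sup>2 / (4 * t)) -
      exp (- (norm x + \<rho> - 2)\<^sup>2 / (4 * t))) * \<rho> * profile \<phi> \<rho>)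
    = (LINT \<rho>|lebesgue. sqrt (4 * pi * t) * (indicator {1..} \<rho> * (F (\<rho> - 1) + F (- (\<rho> - 1)))))"
    unfolding set_lebesgue_integral_def
  proof (rule Bochner_Integration.integral_cong)
    fix \<rho>
    show "indicator {1..} \<rho> *\<^sub>R ((exp (- (norm x - \<rho>)\<^sup>2 / (4 * t)) -
        exp (- (norm x + \<rho> - 2)\<^sup>2 / (4 * t))) * \<rho> * profile \<phi> \<rho>)
      = sqrt (4 * pi * t) * (indicator {1..} \<rho> * (F (\<rho> - 1) + F (- (\<rho> - 1))))"
    proof (cases "\<rho> \<ge> 1")
      case True
      show ?thesis unfolding E[OF True] using True by simp
    qed simp
  qed simp
  also have "\<dots> = (LINT \<rho>|lborel. sqrt (4 * pi * t) * (indicator {1..} \<rho> * (F (\<rho> - 1) + F (- (\<rho> - 1)))))"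
    by (rule integral_completion) (simp add: F_def)
  also have "\<dots> = sqrt (4 * pi * t) * (LINT \<rho>|lborel. indicator {1..} \<rho> * (F (\<rho> - 1) + F (- (\<rho> - 1))))"
    by simp
  also have "(LINT \<rho>|lborel. indicator {1..} \<rho> * (F (\<rho> - 1) + F (- (\<rho> - 1))))
      = (LINT \<eta>|lborel. indicator {0..} \<eta> * F \<eta> + indicator {0..} \<eta> * F (- \<eta>))"
    by (subst lborel_integral_real_affine[where c=1 and t=1])
      (auto intro!: Bochner_Integration.integral_cong simp: indicator_def)
  also have "\<dots> = (LINT \<eta>|lborel. indicator {0..} \<eta> * F \<eta>) + (LINT \<eta>|lborel. indicator {0..} \<eta> * F (- \<eta>))"
    using intF intF' by (intro Bochner_Integration.integral_add ind) auto
  also have "(LINT \<eta>|lborel. indicator {0..} \<eta> * F (- \<eta>)) = (LINT \<eta>|lborel. indicator {..0} \<eta> * F \<eta>)"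
    by (subst lborel_integral_real_affine[where c="-1" and t=0])
      (auto intro!: Bochner_Integration.integral_cong simp: indicator_def)
  also have "(LINT \<eta>|lborel. indicator {0..} \<eta> * F \<eta>) + (LINT \<eta>|lborel. indicator {..0} \<eta> * F \<eta>)
      = (LINT \<eta>|lborel. indicator {0..} \<eta> * F \<eta> + indicator {..0} \<eta> * F \<eta>)"
    using intF by (intro Bochner_Integration.integral_add[symmetric] ind) auto
  \<comment> \<open>The two closed half-lines overlap at 0, where \<open>F\<close> vanishes.\<close>
  also have "\<dots> = (LINT \<eta>|lborel. F \<eta>)"
    by (rule Bochner_Integration.integral_cong) (auto simp: indicator_def F_def)
  finally show ?thesis
    using t by (simp add: S1_def F_def N_def)
qed

lemma profile_norm: "\<rho> \<ge> 0 \<Longrightarrow> profile (\<lambda>x. f (norm x)) \<rho> = f \<rho>"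
  by (simp add: profile_def)

text \<open>Here \<open>\<rho> * (1 - 1 / \<rho>) = \<rho> - 1\<close>, whose odd extension is the
  identity in \<open>\<eta>\<close>, and the mean of a Gaussian is its centre
  \<open>norm x - 1\<close>.\<close>

lemma S1_stationary:
  assumes "t > 0" "x \<in> Omega"
  shows "S1 t (\<lambda>y. 1 - 1 / norm y) x = 1 - 1 / norm x"
proof -
  have "norm x \<ge> 1" "x \<noteq> 0" using assms by (auto simp: Omega_def)
  moreover have "S1 t (\<lambda>y. 1 - 1 / norm y) x =
    (LINT \<eta>|lborel. normal_density (norm x - 1) (sqrt (2 * t)) \<eta> * \<eta>) / norm x"
    using assms
    by (intro S1_odd_extension integrable_normal_moment_nz_1)
      (auto simp: profile_norm[where f="\<lambda>r. 1 - 1 / r"] field_simps)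
  moreover have "(LINT \<eta>|lborel. normal_density (norm x - 1) (sqrt (2 * t)) \<eta> * \<eta>) = norm x - 1"
    using assms by (intro integral_normal_moment_nz_1) simp
  ultimately show ?thesis
    by (simp add: diff_divide_distrib del: integral_mult_left integral_mult_right)
qed

text \<open>Once the Gaussian is centred at 0, the sign changes at \<open>- y\<close>. The
  contributions from beyond \<open>y\<close> and \<open>- y\<close> cancel, leaving the mass of the
  symmetric interval \<open>{-y..y}\<close>, which \<open>erf\<close> measures.\<close>

lemma integral_normal_density_sgn:
  assumes t: "t > 0" and y: "y \<ge> 0"
  shows "(LINT \<eta>|lborel. normal_density y (sqrt (2 * t)) \<eta> * sgn \<eta>) = erf (y / (2 * sqrt t))"
proof -
  define N where "N = normal_density 0 (sqrt (2 * t))"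
  have [measurable]: "N \<in> borel_measurable borel" by (simp add: N_def)
  have intN: "integrable lborel N" using t by (simp add: N_def)
  have ev: "N (- z) = N z" for z by (simp add: N_def normal_density_def)
  \<comment> \<open>\<open>R\<close> is the part of \<open>N z * sgn (y + z)\<close> outside
    \<open>{-y..y}\<close>; it is odd, so its integral is 0.\<close>
  define R where "R z = N z * (indicator {y<..} z - indicator {..<-y} z)" for z
  have "(LINT z|lborel. R z) = (LINT z|lborel. R (- z))"
    by (subst lborel_integral_real_affine[where c="-1" and t=0]) auto
  also have "\<dots> = (LINT z|lborel. - R z)"
    by (rule Bochner_Integration.integral_cong) (auto simp: R_def indicator_def ev)
  finally have R: "(LINT z|lborel. R z) = 0" by simp
  have intR: "integrable lborel R"
    by (rule Bochner_Integration.integrable_bound[OF intN])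
      (auto simp: R_def[abs_def] abs_mult indicator_def mult_left_le)
  have s: "sqrt t > 0" "sqrt t * sqrt t = t" using t by auto
  have "(LINT \<eta>|lborel. normal_density y (sqrt (2 * t)) \<eta> * sgn \<eta>) =
      (LINT z|lborel. N z * sgn (y + z))"
    by (subst lborel_integral_real_affine[where c=1 and t=y]) (auto simp: N_def normal_density_def)
  also have "\<dots> = (LINT z|lborel. indicator {-y..y} z *\<^sub>R N z + R z)"
  proof (rule integral_cong_AE)
    \<comment> \<open>At \<open>z = - y\<close> the sign is 0 while the indicator is 1, so the
      decomposition only holds off that point.\<close>
    show "AE z in lborel. N z * sgn (y + z) = indicator {-y..y} z *\<^sub>R N z + R z"
      using AE_lborel_singleton[of "-y"] by eventually_elim (use y in \<open>auto simp: R_def indicator_def sgn_if\<close>)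
  qed (simp_all add: R_def)
  also have "\<dots> = (LINT z|lborel. indicator {-y..y} z *\<^sub>R N z)"
    using integrable_mult_indicator[of "{-y..y}" lborel N] intN intR R
    by (subst Bochner_Integration.integral_add) auto
  also have "\<dots> = erf (y / (2 * sqrt t)) / 2 - erf (- y / (2 * sqrt t)) / 2"
  proof (rule integral_FTC_atLeastAtMost)
    show "- y \<le> y" using y by simp
    show "continuous_on {- y..y} N"
      using t unfolding N_def normal_density_def by (intro continuous_intros) auto
    fix z
    have N: "2 / sqrt pi * exp (- (z / (2 * sqrt t))\<^sup>2) * (1 / (2 * sqrt t)) / 2 = N z"
    proof -
      obtain k where k: "k > 0" "t = k\<^sup>2"
        using t by (metis real_sqrt_gt_zero real_sqrt_pow2 less_imp_le)
      then show ?thesis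
        by (simp add: N_def normal_density_def power_divide real_sqrt_mult power_mult_distrib)
    qed
    show "((\<lambda>z. erf (z / (2 * sqrt t)) / 2) has_vector_derivative N z) (at z within {- y..y})"
      unfolding has_real_derivative_iff_has_vector_derivative[symmetric] N[symmetric]
      by (rule has_field_derivative_at_within, rule DERIV_cdivide, rule DERIV_chain2[OF DERIV_erf],
        rule DERIV_cdivide, rule DERIV_ident)
  qed
  finally show ?thesis by (simp add: erf_minus)
qed

text \<open>Multiplying \<open>c / \<rho>\<close> by \<open>\<rho>\<close> gives a constant, whose
  odd extension is \<open>c * sgn \<eta>\<close>. Every source term in the \<open>v\<close> equation
  has this shape.\<close>

lemma S1_inverse_norm:
  assumes t: "t \<ge> 0" and x: "x \<in> Omega"
  shows "S1 t (\<lambda>y. c / norm y) x = c / norm x * erf ((norm x - 1) / (2 * sqrt t))"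
proof (cases "t = 0")
  \<comment> \<open>Both sides are 0 by the convention for division by 0. This covers the endpoint
    \<open>s = t\<close> of the Duhamel integral.\<close>
  case True
  then show ?thesis by (simp add: S1_def)
next
  case False
  then have t: "t > 0" using t by simp
  have x: "norm x \<ge> 1" using x by (auto simp: Omega_def)
  define N where "N = normal_density (norm x - 1) (sqrt (2 * t))"
  have [measurable]: "N \<in> borel_measurable borel" by (simp add: N_def)
  have int: "integrable lborel (\<lambda>\<eta>. N \<eta> * (c * sgn \<eta>))"
    by (rule Bochner_Integration.integrable_bound[of _ "\<lambda>\<eta>. \<bar>c\<bar> * N \<eta>"])
      (use t in \<open>auto simp: N_def abs_mult sgn_if\<close>)
  have "S1 t (\<lambda>y. c / norm y) x = (LINT \<eta>|lborel. N \<eta> * (c * sgn \<eta>)) / norm x"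
    unfolding N_def
  proof (rule S1_odd_extension[OF t])
    show "integrable lborel (\<lambda>\<eta>. normal_density (norm x - 1) (sqrt (2 * t)) \<eta> * (c * sgn \<eta>))"
      using int by (simp add: N_def)
  qed (auto simp: profile_norm[where f="\<lambda>r. c / r"] sgn_minus)
  also have "(LINT \<eta>|lborel. N \<eta> * (c * sgn \<eta>)) = (LINT \<eta>|lborel. c * (N \<eta> * sgn \<eta>))"
    by (simp add: mult_ac)
  also have "\<dots> = c * (LINT \<eta>|lborel. N \<eta> * sgn \<eta>)"
    by simp
  finally show ?thesis
    unfolding N_def using integral_normal_density_sgn[OF t, of "norm x - 1"] x by simp
qed

section \<open>The integral equations in terms of the boundary flux\<close>

text \<open>If \<open>f\<close> fails to be integrable, its integral is 0 by convention and the
  bound still holds because \<open>B \<ge> 0\<close>. Arbitrary solutions can thus be estimated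
  without first settling the integrability of their flux. The pointwise bound is imposed on the open
  interval, since the majorants are singular at the endpoints.\<close>

lemma abs_set_lebesgue_integral_le:
  fixes f b :: "real \<Rightarrow> real"
  assumes b: "(b has_integral B) {a..t}"
    and fb: "\<And>s. a < s \<Longrightarrow> s < t \<Longrightarrow> \<bar>f s\<bar> \<le> b s"
  shows "\<bar>LINT s:{a..t}|lebesgue. f s\<bar> \<le> B"
proof -
  have b': "(b has_integral B) {a<..<t}"
    using b by (simp add: has_integral_Icc_iff_Ioo)
  have B0: "B \<ge> 0"
    using b' by (rule has_integral_nonneg) (use fb in force)
  show ?thesis
  proof (cases "set_integrable lebesgue {a..t} f")
    case True
    then have f: "(f has_integral (LINT s:{a..t}|lebesgue. f s)) {a<..<t}"
      using has_integral_set_lebesgue[OF True] by (simp add: has_integral_Icc_iff_Ioo)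
    have "f s \<le> b s" "- b s \<le> f s" if "s \<in> {a<..<t}" for s
      using fb[of s] that by auto
    then show ?thesis
      using has_integral_le[OF f b'] has_integral_le[OF has_integral_neg[OF b'] f]
      by (simp add: abs_le_iff minus_le_iff)
  next
    case False
    then show ?thesis
      using B0 by (simp add: set_lebesgue_integral_def set_integrable_def not_integrable_integral_eq)
  qed
qed

lemma has_integral_inverse_sqrt:
  assumes "t \<ge> 0"
  shows "((\<lambda>s. 1 / sqrt s) has_integral 2 * sqrt t) {0..t}"
proof -
  have "((\<lambda>s. 1 / sqrt s) has_integral (2 * sqrt t - 2 * sqrt 0)) {0..t}"
    using assms
    by (intro fundamental_theorem_of_calculus_interior)
      (auto intro!: continuous_intros derivative_eq_intros
        simp flip: has_real_derivative_iff_has_vector_derivative simp: divide_simps)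
  then show ?thesis by simp
qed

text \<open>This is the Beta integral B(1/2, 1/2). Its independence of \<open>t\<close> keeps the
  Duhamel estimate uniform as \<open>t\<close> tends to 0. The antiderivative has infinite slope at
  both ends, hence the version of the fundamental theorem that differentiates only in the
  interior.\<close>

lemma has_integral_arcsine:
  assumes t: "t > 0"
  shows "((\<lambda>s. 1 / (sqrt s * sqrt (t - s))) has_integral pi) {0..t}"
proof -
  have "((\<lambda>s. 1 / (sqrt s * sqrt (t - s))) has_integral (arcsin (2 * t / t - 1) - arcsin (2 * 0 / t - 1))) {0..t}"
  proof (rule fundamental_theorem_of_calculus_interior)
    show "continuous_on {0..t} (\<lambda>s. arcsin (2 * s / t - 1))"
      using t by (intro continuous_intros) (auto simp: divide_simps)
    fix s assume s: "s \<in> {0<..<t}"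
    have 1: "-1 < 2 * s / t - 1" "2 * s / t - 1 < 1" using s t by (auto simp: field_simps)
    have "sqrt (1 - (2 * s / t - 1)\<^sup>2) = sqrt ((2 / t)\<^sup>2 * (s * (t - s)))"
      using t by (intro arg_cong[of _ _ sqrt]) (simp add: field_simps power2_eq_square)
    also have "\<dots> = 2 / t * (sqrt s * sqrt (t - s))"
      using t by (simp add: real_sqrt_mult)
    finally have 2: "inverse (sqrt (1 - (2 * s / t - 1)\<^sup>2)) * (2 / t) = 1 / (sqrt s * sqrt (t - s))"
      using t s by (simp add: field_simps)
    have "((\<lambda>s. arcsin (2 * s / t - 1)) has_real_derivative
        inverse (sqrt (1 - (2 * s / t - 1)\<^sup>2)) * (2 / t)) (at s)"
      using 1 t by (auto intro!: derivative_eq_intros)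
    then show "((\<lambda>s. arcsin (2 * s / t - 1)) has_vector_derivative 1 / (sqrt s * sqrt (t - s))) (at s)"
      unfolding 2 by (simp add: has_real_derivative_iff_has_vector_derivative)
  qed (use t in simp)
  then show ?thesis using t by (simp add: arcsin_minus)
qed

section \<open>Zero boundary data: both equations expressed through the flux
  \<open>h = g - q\<close>\<close>

definition flux :: "(real ^ 3 \<Rightarrow> real \<Rightarrow> real) \<Rightarrow> real \<Rightarrow> real" where
  "flux v s = normal_trace v s - (LINT \<sigma>:{0..s}|lebesgue. exp (\<sigma> - s) * normal_trace v \<sigma>)"

lemma F1_zero: "F1 0 x t = 0"
  by (simp add: F1_def S2_def)

text \<open>Differentiating the exponential decay in time reproduces it with the opposite sign, so
  the integral in \<open>F2\<close> becomes the memory term of the flux; the spatial factor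
  \<open>1 / norm x\<close> is common to both terms.\<close>

lemma F2_eq_flux: "F2 v x s = - flux v s / norm x"
proof -
  have "deriv (\<lambda>\<tau>. S2 (\<tau> - \<sigma>) g x) s = - (1 / norm x) * (exp (\<sigma> - s) * g)" for \<sigma> g
  proof -
    have "((\<lambda>\<tau>. k * exp (\<sigma> - \<tau>)) has_real_derivative k * - exp (\<sigma> - s)) (at s)" for k
      by (auto intro!: derivative_eq_intros)
    moreover have "(\<lambda>\<tau>. S2 (\<tau> - \<sigma>) g x) = (\<lambda>\<tau>. (g / norm x) * exp (\<sigma> - \<tau>))"
      by (auto simp: S2_def exp_diff fun_eq_iff)
    ultimately have "deriv (\<lambda>\<tau>. S2 (\<tau> - \<sigma>) g x) s = (g / norm x) * - exp (\<sigma> - s)"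
      by (simp only: DERIV_imp_deriv)
    then show ?thesis by simp
  qed
  then have "F2 v x s = - (normal_trace v s / norm x)
      + (1 / norm x) * (LINT \<sigma>:{0..s}|lebesgue. exp (\<sigma> - s) * normal_trace v \<sigma>)"
    unfolding F2_def by (simp only: set_integral_mult_right) (simp add: S2_def)
  then show ?thesis
    unfolding flux_def by (simp add: diff_divide_distrib)
qed

lemma w_equation_zero_iff:
  "w_equation 0 v w \<longleftrightarrow> (\<forall>x\<in>Omega. \<forall>t>0.
     w x t = - (LINT s:{0..t}|lebesgue. exp (s - t) * normal_trace v s) / norm x)"
proof -
  have "S2 (t - s) g x = (1 / norm x) * (exp (s - t) * g)" for t s g and x :: "real ^ 3"
    by (simp add: S2_def exp_diff)
  then show ?thesis
    by (simp add: w_equation_def) (simp add: S2_def)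
qed

abbreviation steady :: "real ^ 3 \<Rightarrow> real" where
  "steady \<equiv> \<lambda>x. 1 - 1 / norm x"

text \<open>The initial datum is stationary, and at each time the source is a multiple of
  \<open>1 / norm y\<close>. Hence \<open>S1_stationary\<close> and \<open>S1_inverse_norm\<close>
  evaluate every occurrence of the heat semigroup, and only a scalar time integral remains.\<close>

lemma v_equation_steady_iff:
  assumes "\<epsilon> > 0"
  shows "v_equation \<epsilon> steady 0 v \<longleftrightarrow> (\<forall>x\<in>Omega. \<forall>t>0.
     v x t = (norm x - 1 + (LINT s:{0..t}|lebesgue.
        flux v s * erf ((norm x - 1) / (2 * sqrt ((t - s) / \<epsilon>))))) / norm x)"
proof -
  have 1: "S1 (t / \<epsilon>) (\<lambda>y. steady y - S2 0 0 y) x = (norm x - 1) / norm x" if "x \<in> Omega" "t > 0" for x t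
    using S1_stationary[OF _ that(1), of "t / \<epsilon>"] that assms
    by (auto simp: S2_def Omega_def diff_divide_distrib)
  have 2: "(LINT s:{0..t}|lebesgue. S1 ((t - s) / \<epsilon>) (\<lambda>y. F1 0 y s + F2 v y s) x)
      = - (1 / norm x) * (LINT s:{0..t}|lebesgue. flux v s * erf ((norm x - 1) / (2 * sqrt ((t - s) / \<epsilon>))))"
    if "x \<in> Omega" for x t
  proof -
    have "(LINT s:{0..t}|lebesgue. S1 ((t - s) / \<epsilon>) (\<lambda>y. F1 0 y s + F2 v y s) x)
      = (LINT s:{0..t}|lebesgue. - (1 / norm x) * (flux v s * erf ((norm x - 1) / (2 * sqrt ((t - s) / \<epsilon>)))))"
      unfolding F1_zero F2_eq_flux set_lebesgue_integral_def add_0_left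
    proof (rule Bochner_Integration.integral_cong)
      fix s
      show "indicator {0..t} s *\<^sub>R S1 ((t - s) / \<epsilon>) (\<lambda>y. - flux v s / norm y) x = indicator {0..t} s *\<^sub>R
        (- (1 / norm x) * (flux v s * erf ((norm x - 1) / (2 * sqrt ((t - s) / \<epsilon>)))))"
      proof (cases "s \<in> {0..t}")
        case True
        then have "(t - s) / \<epsilon> \<ge> 0" using assms by simp
        from S1_inverse_norm[OF this that, of "- flux v s"] show ?thesis by simp
      qed simp
    qed simp
    then show ?thesis unfolding set_integral_mult_right .
  qed
  have 3: "a / n - - (1 / n) * J = (a + J) / n" for a n J :: real
    by (simp add: add_divide_distrib)
  have "S1 (t / \<epsilon>) (\<lambda>y. steady y - S2 0 0 y) x
      - (LINT s:{0..t}|lebesgue. S1 ((t - s) / \<epsilon>) (\<lambda>y. F1 0 y s + F2 v y s) x) =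
     (norm x - 1 + (LINT s:{0..t}|lebesgue. flux v s * erf ((norm x - 1) / (2 * sqrt ((t - s) / \<epsilon>))))) / norm x"
    if "x \<in> Omega" "t > 0" for x t
    unfolding 1[OF that] 2[OF that(1)] by (rule 3)
  then show ?thesis
    unfolding v_equation_def by (intro ball_cong refl all_cong1 imp_cong) (simp only:)
qed

section \<open>Lower bound for arbitrary solutions\<close>

abbreviation e1 :: "real ^ 3" where
  "e1 \<equiv> axis 1 1"

text \<open>This transfers the norm bound in the solution class to the unit sphere, a null set. If
  \<open>f\<close> exceeded its essential bound at \<open>x\<close>, by continuity it would do so on
  a whole ball inside \<open>Omega\<close>.\<close>

lemma abs_le_Linf_norm:
  assumes f: "continuous_on Omega f" and x: "x \<in> Omega"
  shows "ennreal \<bar>f x\<bar> \<le> Linf_norm f"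
proof (rule ccontr)
  assume *: "\<not> ennreal \<bar>f x\<bar> \<le> Linf_norm f"
  then obtain c where c: "Linf_norm f = ennreal c" "c \<ge> 0"
    by (metis ennreal_cases top_greatest)
  then have "c < \<bar>f x\<bar>" using * by (simp add: not_le ennreal_less_iff)
  have "continuous_on Omega (\<lambda>y. \<bar>f y\<bar>)" using f by (intro continuous_intros)
  then obtain d where d: "d > 0" "\<And>y. y \<in> Omega \<Longrightarrow> dist y x < d \<Longrightarrow> dist \<bar>f y\<bar> \<bar>f x\<bar> < \<bar>f x\<bar> - c"
    using x \<open>c < \<bar>f x\<bar>\<close> unfolding continuous_on_iff
    by (elim ballE[of _ _ x] allE[of _ "\<bar>f x\<bar> - c"]) auto
  have x1: "norm x \<ge> 1" using x by (auto simp: Omega_def)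
  \<comment> \<open>Since \<open>x\<close> may lie on the unit sphere, the ball is centred at
    distance \<open>d / 2\<close> further out: with radius \<open>d / 2\<close> it stays in
    \<open>Omega\<close> and within distance \<open>d\<close> of \<open>x\<close>.\<close>
  define z where "z = x + (d / 2) *\<^sub>R sgn x"
  have zx: "dist z x = d / 2" using x1 d by (auto simp: z_def dist_norm norm_sgn)
  have nz: "norm z = norm x + d / 2"
  proof -
    have "x \<noteq> 0" using x1 by auto
    then have "norm x *\<^sub>R sgn x = x"
      by (simp add: sgn_div_norm)
    then have "z = (norm x + d / 2) *\<^sub>R sgn x"
      by (simp add: z_def scaleR_left_distrib)
    then show ?thesis using x1 d by (auto simp: norm_sgn)
  qed
  have AE: "AE y in lebesgue. y \<in> Omega \<longrightarrow> ennreal \<bar>f y\<bar> \<le> ennreal c"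
    using esssup_AE[of "\<lambda>x. ennreal \<bar>f x\<bar>" "lebesgue_on Omega"] c
    by (simp add: AE_restrict_space_iff Linf_norm_def Omega_def)
  have "y \<in> Omega" "\<bar>f y\<bar> > c" if "y \<in> ball z (d / 2)" for y
  proof -
    have "norm y > norm z - d / 2"
      using that norm_triangle_ineq2[of z y] by (simp add: dist_norm)
    then show y: "y \<in> Omega" using nz x1 by (simp add: Omega_def)
    have "dist y x < d"
      using that zx dist_triangle[of y x z] by (simp add: dist_commute)
    from d(2)[OF y this] show "\<bar>f y\<bar> > c" by (simp add: dist_real_def)
  qed
  then have "AE y in lebesgue. y \<notin> ball z (d / 2)"
    using AE c by (auto simp: not_le elim!: eventually_mono dest: leD)
  then have "ball z (d / 2) \<in> null_sets lebesgue"
    by (subst (asm) AE_iff_null_sets[symmetric]) auto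
  then have "negligible (ball z (d / 2))"
    by (simp add: negligible_iff_null_sets)
  then show False using open_not_negligible[of "ball z (d / 2)"] d by simp
qed

lemma borel_measurable_Omega:
  "continuous_on Omega f \<Longrightarrow> f \<in> borel_measurable (lebesgue_on Omega)" for f :: "real ^ 3 \<Rightarrow> real"
  by (rule continuous_imp_measurable_on_sets_lebesgue) (simp_all add: Omega_def)

text \<open>Continuity supplies the measurability without which the essential supremum would be
  infinite.\<close>

lemma Linf_norm_le:
  assumes f: "continuous_on Omega f" and "\<And>x. x \<in> Omega \<Longrightarrow> \<bar>f x\<bar> \<le> C"
  shows "Linf_norm f \<le> ennreal C"
  unfolding Linf_norm_def
proof (rule esssup_I)
  show "(\<lambda>x. ennreal \<bar>f x\<bar>) \<in> borel_measurable (lebesgue_on Omega)"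
    using borel_measurable_Omega[OF f] by measurable
  show "AE x in lebesgue_on Omega. ennreal \<bar>f x\<bar> \<le> ennreal C"
    using assms(2) by (intro AE_I2 ennreal_leI) simp
qed

lemma e1_Omega [simp]: "e1 \<in> Omega"
  by (simp add: Omega_def)

text \<open>The bound \<open>M\<close> may depend on the solution and on \<epsilon>. Its purpose is
  qualitative: it makes the supremum in \<open>normal_trace_apriori\<close> finite.\<close>

lemma normal_trace_bounded:
  assumes sol: "radial_global_solution \<epsilon> \<phi> \<phi>b v w" and \<epsilon>: "\<epsilon> > 0" and T: "T > 0"
  obtains M where "\<And>t. 0 < t \<Longrightarrow> t < T \<Longrightarrow> sqrt t * \<bar>normal_trace v t\<bar> \<le> M"
proof -
  let ?B = "\<lambda>t. Linf_norm (\<lambda>x. v x t)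
        + ennreal (sqrt (t / \<epsilon>)) * Linf_norm (normal_deriv (\<lambda>x. v x t))
        + Linf_norm (\<lambda>x. w x t)"
  have "(SUP t\<in>{0<..<T}. ?B t) < \<infinity>"
    using sol T by (simp add: radial_global_solution_def)
  then obtain K where K: "(SUP t\<in>{0<..<T}. ?B t) = ennreal K" "K \<ge> 0"
    by (cases "SUP t\<in>{0<..<T}. ?B t") auto
  show ?thesis
  proof (rule that[of "K * sqrt \<epsilon>"])
    fix t assume t: "0 < t" "t < T"
    let ?g = "normal_deriv (\<lambda>x. v x t)"
    have "continuous_on (Omega \<times> {0<..}) (\<lambda>(x, t). normal_deriv (\<lambda>y. v y t) x)"
      using sol by (simp add: radial_global_solution_def global_solution_def)
    then have "continuous_on Omega (\<lambda>x. (\<lambda>(x, t). normal_deriv (\<lambda>y. v y t) x) (x, t))"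
      by (rule continuous_on_compose2) (use t in \<open>auto intro!: continuous_intros\<close>)
    then have "continuous_on Omega ?g" by simp
    then have "ennreal \<bar>?g e1\<bar> \<le> Linf_norm ?g" by (rule abs_le_Linf_norm) simp
    then have "ennreal (sqrt (t / \<epsilon>)) * ennreal \<bar>?g e1\<bar> \<le> ennreal (sqrt (t / \<epsilon>)) * Linf_norm ?g"
      by (rule mult_left_mono) simp
    also have "\<dots> \<le> ?B t" by (simp add: add_increasing add_increasing2)
    also have "\<dots> \<le> (SUP t\<in>{0<..<T}. ?B t)" using t by (intro SUP_upper) simp
    finally have "ennreal (sqrt (t / \<epsilon>) * \<bar>?g e1\<bar>) \<le> ennreal K"
      using t \<epsilon> K by (simp add: ennreal_mult)
    then have "sqrt (t / \<epsilon>) * \<bar>?g e1\<bar> \<le> K" using K by simp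
    then show "sqrt t * \<bar>normal_trace v t\<bar> \<le> K * sqrt \<epsilon>"
      using \<epsilon> by (simp add: normal_trace_def profile_def real_sqrt_divide field_simps)
  qed
qed

lemma at_within_atLeast_neq_bot: "x \<ge> a \<Longrightarrow> at x within {a..} \<noteq> bot" for a x :: real
proof -
  assume "x \<ge> a"
  then have "at_right x \<le> at x within {a..}" by (intro at_le) auto
  then show ?thesis using trivial_limit_at_right_real[of x] bot_unique by metis
qed

section \<open>Estimates in terms of a bound \<open>N\<close> for the weighted normal trace\<close>

context
  fixes \<epsilon> T N :: real and v :: "real ^ 3 \<Rightarrow> real \<Rightarrow> real"
  assumes \<epsilon>: "\<epsilon> > 0" and T: "T \<le> 1"
    and N: "\<And>s. 0 < s \<Longrightarrow> s < T \<Longrightarrow> sqrt s * \<bar>normal_trace v s\<bar> \<le> N"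
begin

lemma abs_normal_trace_le: "0 < s \<Longrightarrow> s < T \<Longrightarrow> \<bar>normal_trace v s\<bar> \<le> N * (1 / sqrt s)"
  using N[of s] by (simp add: field_simps)

lemma abs_memory_le:
  assumes "0 < t" "t < T"
  shows "\<bar>LINT s:{0..t}|lebesgue. exp (s - t) * normal_trace v s\<bar> \<le> 2 * N * sqrt t"
proof -
  have b: "((\<lambda>s. N * (1 / sqrt s)) has_integral N * (2 * sqrt t)) {0..t}"
    using assms by (intro has_integral_mult_right has_integral_inverse_sqrt) simp
  have "\<bar>LINT s:{0..t}|lebesgue. exp (s - t) * normal_trace v s\<bar> \<le> N * (2 * sqrt t)"
  proof (rule abs_set_lebesgue_integral_le[OF b])
    fix s assume s: "0 < s" "s < t"
    have "\<bar>exp (s - t) * normal_trace v s\<bar> \<le> 1 * \<bar>normal_trace v s\<bar>"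
      unfolding abs_mult by (rule mult_right_mono) (use s in auto)
    also have "\<dots> \<le> N * (1 / sqrt s)" using abs_normal_trace_le[of s] s assms by simp
    finally show "\<bar>exp (s - t) * normal_trace v s\<bar> \<le> N * (1 / sqrt s)" .
  qed
  then show ?thesis by simp
qed

text \<open>The trace contributes \<open>N / sqrt s\<close>. The memory term contributes
  \<open>2 * N * sqrt s\<close>, which is at most \<open>2 * N / sqrt s\<close> because
  \<open>s < T \<le> 1\<close>.\<close>

lemma abs_flux_le:
  assumes s: "0 < s" "s < T"
  shows "\<bar>flux v s\<bar> \<le> 3 * N / sqrt s"
proof -
  have "N \<ge> 0" using N[OF s] s by (meson abs_ge_zero mult_nonneg_nonneg order_trans real_sqrt_ge_zero less_imp_le)
  have "s * N \<le> 1 * N" using s T \<open>N \<ge> 0\<close> by (intro mult_right_mono) auto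
  then have "2 * N * sqrt s \<le> 2 * N / sqrt s"
    using s by (simp add: field_simps)
  then show ?thesis
    using abs_memory_le[OF s] abs_normal_trace_le[OF s] by (simp add: flux_def)
qed

text \<open>The flux bound has the singularity \<open>1 / sqrt s\<close>, and the linear bound on
  \<open>erf\<close> has the singularity \<open>1 / sqrt (t - s)\<close>. Their product integrates
  to \<open>pi\<close> by \<open>has_integral_arcsine\<close>, and
  \<open>pi / sqrt pi = sqrt pi\<close>.\<close>

lemma abs_duhamel_le:
  assumes t: "0 < t" "t < T" and y: "y \<ge> 0"
  shows "\<bar>LINT s:{0..t}|lebesgue. flux v s * erf (y / (2 * sqrt ((t - s) / \<epsilon>)))\<bar> \<le> 3 * N * sqrt (pi * \<epsilon>) * y"
proof -
  let ?c = "3 * N * sqrt \<epsilon> * y / sqrt pi"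
  have b: "((\<lambda>s. ?c * (1 / (sqrt s * sqrt (t - s)))) has_integral ?c * pi) {0..t}"
    using t by (intro has_integral_mult_right has_integral_arcsine) simp
  have "\<bar>LINT s:{0..t}|lebesgue. flux v s * erf (y / (2 * sqrt ((t - s) / \<epsilon>)))\<bar> \<le> ?c * pi"
  proof (rule abs_set_lebesgue_integral_le[OF b])
    fix s assume s: "0 < s" "s < t"
    have "\<bar>flux v s * erf (y / (2 * sqrt ((t - s) / \<epsilon>)))\<bar> \<le>
        (3 * N / sqrt s) * (2 / sqrt pi * \<bar>y / (2 * sqrt ((t - s) / \<epsilon>))\<bar>)"
      unfolding abs_mult using abs_flux_le[of s] s t
      by (intro mult_mono abs_erf_le) auto
    also have "\<dots> = ?c * (1 / (sqrt s * sqrt (t - s)))"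
      using s \<epsilon> y by (simp add: real_sqrt_divide mult_ac)
    finally show "\<bar>flux v s * erf (y / (2 * sqrt ((t - s) / \<epsilon>)))\<bar> \<le> ?c * (1 / (sqrt s * sqrt (t - s)))" .
  qed
  also have "?c * pi = 3 * N * sqrt \<epsilon> * y * (pi / sqrt pi)"
    by simp
  also have "\<dots> = 3 * N * sqrt (pi * \<epsilon>) * y"
    using real_div_sqrt[of pi] by (simp only: pi_ge_zero) (simp add: real_sqrt_mult)
  finally show ?thesis .
qed

text \<open>The normal trace is read off from difference quotients at the boundary, so a linear bound on
  the Duhamel term suffices and no differentiation under the integral sign is needed.\<close>
lemma abs_normal_trace_le':
  assumes v: "v_equation \<epsilon> steady 0 v" and nd: "normal_differentiable (\<lambda>y. v y t) e1"
    and t: "0 < t" "t < T"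
  shows "\<bar>normal_trace v t\<bar> \<le> 1 + 3 * N * sqrt (pi * \<epsilon>)"
proof -
  let ?f = "\<lambda>\<rho>. v (\<rho> *\<^sub>R sgn e1) t"
  let ?X = "3 * N * sqrt (pi * \<epsilon>)"
  define D where "D = vector_derivative ?f (at 1 within {1..})"
  have g: "normal_trace v t = - D"
    by (simp add: normal_trace_def profile_def normal_deriv_def D_def)
  have "?f differentiable (at 1 within {1..})"
    using nd by (simp add: normal_differentiable_def)
  then have "(?f has_vector_derivative D) (at 1 within {1..})"
    by (simp add: D_def vector_derivative_works)
  then have lim: "((\<lambda>\<rho>. (?f \<rho> - ?f 1) / (\<rho> - 1)) \<longlongrightarrow> D) (at 1 within {1..})"
    by (simp add: has_field_derivative_iff flip: has_real_derivative_iff_has_vector_derivative)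
  have f: "?f \<rho> = (\<rho> - 1 + (LINT s:{0..t}|lebesgue. flux v s * erf ((\<rho> - 1) / (2 * sqrt ((t - s) / \<epsilon>))))) / \<rho>"
    if "\<rho> \<ge> 1" for \<rho>
  proof -
    have "\<rho> *\<^sub>R sgn e1 \<in> Omega" using that by (simp add: Omega_def norm_sgn)
    then show ?thesis
      using v_equation_steady_iff[OF \<epsilon>, of v] v t that by (auto simp: norm_sgn)
  qed
  have q: "\<bar>(?f \<rho> - ?f 1) / (\<rho> - 1)\<bar> \<le> 1 + ?X" if "\<rho> > 1" for \<rho>
  proof -
    \<comment> \<open>Taken at \<open>y = 1\<close>, the Duhamel estimate bounds an absolute value
      by \<open>?X\<close>, so \<open>?X\<close> is nonnegative.\<close>
    have "0 \<le> 1 + ?X"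
      using abs_duhamel_le[OF t, of 1] by simp
    let ?J = "LINT s:{0..t}|lebesgue. flux v s * erf ((\<rho> - 1) / (2 * sqrt ((t - s) / \<epsilon>)))"
    have "?f 1 = 0" using f[of 1] by simp
    have "\<bar>\<rho> - 1 + ?J\<bar> \<le> (1 + ?X) * (\<rho> - 1)"
      using abs_duhamel_le[OF t, of "\<rho> - 1"] that by (simp add: algebra_simps)
    then have "\<bar>(?f \<rho> - ?f 1) / (\<rho> - 1)\<bar> \<le> (1 + ?X) / \<rho>"
      using that f[of \<rho>] unfolding \<open>?f 1 = 0\<close> by (simp add: abs_mult field_simps)
    also have "\<dots> \<le> 1 + ?X"
      using that \<open>0 \<le> 1 + ?X\<close> by (simp add: divide_le_eq mult_le_cancel_left1)
    finally show ?thesis .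
  qed
  have "\<bar>D\<bar> \<le> 1 + ?X"
  proof (rule tendsto_upperbound[OF tendsto_rabs[OF lim]])
    show "\<forall>\<^sub>F \<rho> in at 1 within {1..}. \<bar>(?f \<rho> - ?f 1) / (\<rho> - 1)\<bar> \<le> 1 + ?X"
      using q by (auto simp: eventually_at_filter)
  qed (use at_within_atLeast_neq_bot[of 1 1] in simp)
  then show ?thesis by (simp add: g)
qed

end

text \<open>The value \<open>1 / 12\<close> makes \<open>3 * N * sqrt (pi * \<epsilon>)\<close> at
  most \<open>N / 4\<close>; the threshold \<open>1 / 1000\<close> suffices because 4/1000 <
  1/144.\<close>

lemma sqrt_pi_mult_le:
  assumes "0 < \<epsilon>" "\<epsilon> < 1 / 1000"
  shows "sqrt (pi * \<epsilon>) \<le> 1 / 12"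
proof -
  have "sqrt (pi * \<epsilon>) \<le> sqrt ((1 / 12)\<^sup>2)"
    using assms pi_less_4 mult_strict_mono[of pi 4 \<epsilon> "1 / 1000"]
    by (intro real_sqrt_le_mono) (auto simp: power2_eq_square)
  then show ?thesis by simp
qed

text \<open>The supremum \<open>N\<close> of the weighted trace satisfies
  \<open>N \<le> 1 + N / 4\<close>. Being finite by \<open>normal_trace_bounded\<close>, it can be
  absorbed, which gives \<open>N \<le> 4 / 3\<close>.\<close>

lemma normal_trace_apriori:
  assumes sol: "radial_global_solution \<epsilon> steady 0 v w"
    and \<epsilon>: "0 < \<epsilon>" "\<epsilon> < 1 / 1000" and t: "0 < t" "t < 1"
  shows "sqrt t * \<bar>normal_trace v t\<bar> \<le> 2"
proof -
  let ?g = "\<lambda>t. sqrt t * \<bar>normal_trace v t\<bar>"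
  define N where "N = (SUP t\<in>{0<..<1}. ?g t)"
  obtain M where M: "\<And>t. 0 < t \<Longrightarrow> t < 1 \<Longrightarrow> ?g t \<le> M"
    using normal_trace_bounded[OF sol \<epsilon>(1), of 1] by auto
  then have bdd: "bdd_above (?g ` {0<..<1})" by (auto intro!: bdd_aboveI)
  have N: "?g s \<le> N" if "0 < s" "s < 1" for s
    unfolding N_def using that bdd by (intro cSUP_upper) auto
  have N0: "0 \<le> N" using N[OF t] t by (meson abs_ge_zero mult_nonneg_nonneg order_trans real_sqrt_ge_zero less_imp_le)
  note sq = sqrt_pi_mult_le[OF \<epsilon>]
  have "?g s \<le> 1 + N / 4" if s: "0 < s" "s < 1" for s
  proof -
    have "?g s \<le> 1 * \<bar>normal_trace v s\<bar>"
      using s by (intro mult_right_mono) auto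
    also have "\<dots> \<le> 1 + 3 * N * sqrt (pi * \<epsilon>)"
      using abs_normal_trace_le'[OF \<epsilon>(1) order_refl N, of s] sol s
      by (simp add: radial_global_solution_def global_solution_def)
    also have "\<dots> \<le> 1 + 3 * N * (1 / 12)"
      using sq N0 by (intro add_left_mono mult_left_mono) auto
    finally show ?thesis by simp
  qed
  then have "N \<le> 1 + N / 4" unfolding N_def by (intro cSUP_least) auto
  then show ?thesis using N[OF t] by simp
qed

text \<open>In \<open>norm x * (v x t + w x t) = ?y + ?J - ?q\<close> the Duhamel term costs at most
  \<open>?y / 2\<close>. The memory term costs at most \<open>4 * sqrt t\<close>, hence at most
  \<open>?y / 4\<close> because \<open>r - 1 \<le> ?y\<close>. What is left is
  \<open>?y / 4\<close>, and \<open>?y / norm x = 1 - 1 / norm x\<close> increases with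
  \<open>norm x\<close>.\<close>

lemma solution_lower_bound:
  assumes sol: "radial_global_solution \<epsilon> steady 0 v w"
    and \<epsilon>: "0 < \<epsilon>" "\<epsilon> < 1 / 1000" and t: "0 < t" "t < 1" "4 * sqrt t \<le> (r - 1) / 4"
    and r: "r > 1" "norm x \<ge> r"
  shows "v x t + w x t \<ge> (1 - 1 / r) / 4"
proof -
  let ?y = "norm x - 1"
  let ?J = "LINT s:{0..t}|lebesgue. flux v s * erf (?y / (2 * sqrt ((t - s) / \<epsilon>)))"
  let ?q = "LINT s:{0..t}|lebesgue. exp (s - t) * normal_trace v s"
  have x: "x \<in> Omega" using r by (auto simp: Omega_def)
  note N = normal_trace_apriori[OF sol \<epsilon>]
  note sq = sqrt_pi_mult_le[OF \<epsilon>]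
  have "\<bar>?J\<bar> \<le> 3 * 2 * sqrt (pi * \<epsilon>) * ?y"
    by (rule abs_duhamel_le[OF \<epsilon>(1) order_refl N]) (use t r in auto)
  also have "\<dots> \<le> 3 * 2 * (1 / 12) * ?y"
    using sq r by (intro mult_right_mono mult_left_mono) auto
  finally have J: "\<bar>?J\<bar> \<le> ?y / 2" by simp
  have q: "\<bar>?q\<bar> \<le> 2 * 2 * sqrt t"
    by (rule abs_memory_le[OF \<epsilon>(1) order_refl N]) (use t in auto)
  have "v x t + w x t = (?y + ?J - ?q) / norm x"
    using sol x t v_equation_steady_iff[OF \<epsilon>(1), of v] w_equation_zero_iff[of v w]
    by (simp add: radial_global_solution_def global_solution_def diff_divide_distrib)
  also have "\<dots> \<ge> (?y / 4) / norm x"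
    using J q t r by (intro divide_right_mono) auto
  also have "(?y / 4) / norm x = (1 - 1 / norm x) / 4"
  proof -
    have "norm x \<noteq> 0" using r by linarith
    then show ?thesis by (simp add: diff_divide_distrib del: norm_eq_zero)
  qed
  finally have "v x t + w x t \<ge> (1 - 1 / norm x) / 4" .
  moreover have "1 / norm x \<le> 1 / r" using r by (intro frac_le) auto
  ultimately show ?thesis by argo
qed

section \<open>Dominated convergence on the unit interval\<close>

text \<open>Nonnegativity turns a gauge integral into a Lebesgue integral, so antiderivatives can be
  used for singular integrands. The open interval leaves out the singular endpoints.\<close>

lemma set_integral_eq_has_integral:
  fixes f :: "real \<Rightarrow> real"
  assumes f: "(f has_integral I) {a..b}" and [measurable]: "f \<in> borel_measurable borel"
    and nonneg: "\<And>u. a < u \<Longrightarrow> u < b \<Longrightarrow> f u \<ge> 0"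
  shows "set_integrable lborel {a<..<b} f" "(LINT u:{a<..<b}|lborel. f u) = I"
proof -
  have f': "(f has_integral I) {a<..<b}"
    using f by (simp add: has_integral_Icc_iff_Ioo)
  then have "f absolutely_integrable_on {a<..<b}"
    using nonneg by (intro nonnegative_absolutely_integrable_1) auto
  then show "set_integrable lborel {a<..<b} f"
    unfolding set_integrable_def by (subst (asm) integrable_completion) auto
  from set_borel_integral_eq_integral(2)[OF this] show "(LINT u:{a<..<b}|lborel. f u) = I"
    using f' by (simp add: integral_unique)
qed

text \<open>Multiples of this function dominate the rescaled Duhamel integrands and their
  \<open>y\<close>-derivatives.\<close>

lemma set_integrable_inverse_sqrt: "set_integrable lborel {0<..<1} (\<lambda>u::real. 1 / sqrt u)"
  using has_integral_inverse_sqrt[of 1] by (intro set_integral_eq_has_integral(1)) auto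

lemma set_integrable_scaled_inverse_sqrt:
  "set_integrable lborel {0<..<1} (\<lambda>u. a * (1 / sqrt u))" for a :: real
  by (intro set_integrable_mult_right set_integrable_inverse_sqrt)

lemma integral_scaled_inverse_sqrt: "(LINT u:{0<..<1}|lborel. a * (1 / sqrt u)) = 2 * a" for a :: real
  unfolding set_integral_mult_right
  using set_integral_eq_has_integral(2)[OF has_integral_inverse_sqrt[of 1]] by simp

lemma set_integrable_kernel: "set_integrable lborel {0<..<1} (\<lambda>u::real. a + b / sqrt u)"
proof -
  note set_integrable_scaled_inverse_sqrt[of b]
  moreover have "set_integrable lborel {0<..<1} (\<lambda>u::real. a)"
    by (simp add: set_integrable_def)
  ultimately show ?thesis
    using set_integral_add(1) by fastforce
qed

lemma abs_set_integral_le: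
  fixes f g :: "real \<Rightarrow> real"
  assumes g: "set_integrable lborel A g" and A: "A \<in> sets borel"
    and fg: "\<And>u. u \<in> A \<Longrightarrow> \<bar>f u\<bar> \<le> g u"
  shows "\<bar>LINT u:A|lborel. f u\<bar> \<le> (LINT u:A|lborel. g u)"
proof (cases "set_integrable lborel A f")
  case True
  have "norm (LINT u:A|lborel. f u) \<le> (LINT u:A|lborel. norm (f u))"
    by (rule set_integral_norm_bound[OF True])
  also have "\<dots> \<le> (LINT u:A|lborel. g u)"
    using True g fg by (intro set_integral_mono set_integrable_norm) auto
  finally show ?thesis by simp
next
  case False
  moreover have "0 \<le> (LINT u:A|lborel. g u)"
    using fg unfolding set_lebesgue_integral_def
    by (intro Bochner_Integration.integral_nonneg) (force simp: indicator_def)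
  ultimately show ?thesis
    by (simp add: set_lebesgue_integral_def set_integrable_def not_integrable_integral_eq)
qed

lemma set_integrable_dominated:
  fixes f g :: "real \<Rightarrow> real"
  assumes g: "set_integrable lborel A g" and [measurable]: "A \<in> sets borel" "f \<in> borel_measurable borel"
    and fg: "\<And>u. u \<in> A \<Longrightarrow> \<bar>f u\<bar> \<le> g u"
  shows "set_integrable lborel A f"
  using g unfolding set_integrable_def
  by (rule Bochner_Integration.integrable_bound) (use fg in \<open>force simp: indicator_def\<close>)+

lemma set_integral_dominated_convergence:
  fixes f :: "real \<Rightarrow> real"
  assumes g: "set_integrable lborel A g" and [measurable]: "A \<in> sets borel"
      "f \<in> borel_measurable borel" "\<And>n. s n \<in> borel_measurable borel"
    and lim: "\<And>u. u \<in> A \<Longrightarrow> (\<lambda>n. s n u) \<longlonglongrightarrow> f u"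
    and bound: "\<And>n u. u \<in> A \<Longrightarrow> \<bar>s n u\<bar> \<le> g u"
  shows "(\<lambda>n. LINT u:A|lborel. s n u) \<longlonglongrightarrow> (LINT u:A|lborel. f u)"
  unfolding set_lebesgue_integral_def
proof (rule integral_dominated_convergence[where w="\<lambda>u. indicator A u *\<^sub>R g u"])
  show "AE u in lborel. (\<lambda>n. indicator A u *\<^sub>R s n u) \<longlonglongrightarrow> indicator A u *\<^sub>R f u"
    using lim by (auto simp: indicator_def)
qed (use g bound in \<open>auto simp: set_integrable_def indicator_def\<close>)

text \<open>The dominating function may vary with \<open>p\<close> and has to work only within
  distance 1 of it, because the kernels below grow with time.\<close>

lemma continuous_on_set_integral_dominated:
  fixes f :: "'a::metric_space \<Rightarrow> real \<Rightarrow> real"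
  assumes [measurable]: "A \<in> sets borel" "\<And>p. f p \<in> borel_measurable borel"
    and cont: "\<And>u. u \<in> A \<Longrightarrow> continuous_on S (\<lambda>p. f p u)"
    and bound: "\<And>p. p \<in> S \<Longrightarrow> \<exists>g. set_integrable lborel A g \<and>
      (\<forall>q\<in>S. dist q p < 1 \<longrightarrow> (\<forall>u\<in>A. \<bar>f q u\<bar> \<le> g u))"
  shows "continuous_on S (\<lambda>p. LINT u:A|lborel. f p u)"
  unfolding continuous_on_sequentially
proof (intro allI ballI impI, elim conjE)
  fix X p assume p: "p \<in> S" and X: "\<forall>n. X n \<in> S" "X \<longlonglongrightarrow> p"
  obtain g where g: "set_integrable lborel A g"
      "\<And>q u. q \<in> S \<Longrightarrow> dist q p < 1 \<Longrightarrow> u \<in> A \<Longrightarrow> \<bar>f q u\<bar> \<le> g u"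
    using bound[OF p] by auto
  obtain m where m: "\<And>n. n \<ge> m \<Longrightarrow> dist (X n) p < 1"
    using metric_LIMSEQ_D[OF X(2), of 1] by auto
  \<comment> \<open>Dropping the first \<open>m\<close> terms puts the whole sequence inside the
    region where \<open>g\<close> dominates.\<close>
  have "(\<lambda>n. LINT u:A|lborel. f (X (n + m)) u) \<longlonglongrightarrow> (LINT u:A|lborel. f p u)"
  proof (rule set_integral_dominated_convergence[OF g(1)])
    fix u assume "u \<in> A"
    then show "(\<lambda>n. f (X (n + m)) u) \<longlonglongrightarrow> f p u"
      using cont[of u] p X LIMSEQ_ignore_initial_segment[OF X(2), of m]
      unfolding continuous_on_sequentially by (auto simp: comp_def)
  qed (use X m g in auto)
  then show "((\<lambda>p. LINT u:A|lborel. f p u) \<circ> X) \<longlonglongrightarrow> (LINT u:A|lborel. f p u)"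
    unfolding comp_def by (rule LIMSEQ_offset)
qed

text \<open>The mean value inequality bounds the difference quotients by \<open>g\<close>, so
  dominated convergence applies along every sequence tending to \<open>p\<close>.\<close>

lemma has_real_derivative_set_integral:
  fixes f f' :: "real \<Rightarrow> real \<Rightarrow> real"
  assumes g: "set_integrable lborel A g" and [measurable]: "A \<in> sets borel"
      "\<And>p. f p \<in> borel_measurable borel" "\<And>p. f' p \<in> borel_measurable borel"
    and deriv: "\<And>p u. u \<in> A \<Longrightarrow> ((\<lambda>p. f p u) has_real_derivative f' p u) (at p)"
    and bound: "\<And>p u. u \<in> A \<Longrightarrow> \<bar>f' p u\<bar> \<le> g u"
    and int: "\<And>p. set_integrable lborel A (f p)"
  shows "((\<lambda>p. LINT u:A|lborel. f p u) has_real_derivative (LINT u:A|lborel. f' p u)) (at p)"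
  unfolding has_field_derivative_iff tendsto_at_iff_sequentially
proof (intro allI impI)
  fix X :: "nat \<Rightarrow> real" assume X: "\<forall>i. X i \<in> UNIV - {p}" "X \<longlonglongrightarrow> p"
  have "(\<lambda>n. LINT u:A|lborel. (f (X n) u - f p u) / (X n - p)) \<longlonglongrightarrow> (LINT u:A|lborel. f' p u)"
  proof (rule set_integral_dominated_convergence[OF g])
    fix u assume u: "u \<in> A"
    show "(\<lambda>n. (f (X n) u - f p u) / (X n - p)) \<longlonglongrightarrow> f' p u"
      using deriv[OF u, of p] X
      unfolding has_field_derivative_iff tendsto_at_iff_sequentially comp_def by blast
    fix n
    have "norm (f (X n) u - f p u) \<le> g u * norm (X n - p)"
      by (rule field_differentiable_bound[OF convex_UNIV deriv[OF u]]) (use bound u in auto)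
    then show "\<bar>(f (X n) u - f p u) / (X n - p)\<bar> \<le> g u"
      using X(1) by (simp add: divide_le_eq)
  qed auto
  moreover have "(LINT u:A|lborel. (f (X n) u - f p u) / (X n - p)) =
      ((LINT u:A|lborel. f (X n) u) - (LINT u:A|lborel. f p u)) / (X n - p)" for n
    using int by (subst set_integral_divide_zero) (simp add: set_integral_diff)
  ultimately show "((\<lambda>q. ((LINT u:A|lborel. f q u) - (LINT u:A|lborel. f p u)) / (q - p)) \<circ> X)
      \<longlonglongrightarrow> (LINT u:A|lborel. f' p u)"
    by (simp only: comp_def)
qed

text \<open>The substitution \<open>s = t * (1 - u)\<close> fixes the domain of integration, so that
  \<open>t\<close> becomes a mere parameter. As \<open>t - s = t * u\<close>, the singularity at
  \<open>s = t\<close> moves to \<open>u = 0\<close>.\<close>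

lemma set_integral_rescale:
  fixes F :: "real \<Rightarrow> real"
  assumes t: "t \<ge> 0" and [measurable]: "F \<in> borel_measurable borel"
  shows "(LINT s:{0..t}|lebesgue. F s) = (LINT u:{0<..<1}|lborel. t * F (t * (1 - u)))"
proof (cases "t = 0")
  case True
  have "(LINT s|lborel. indicator {0..t} s *\<^sub>R F s) = 0"
    by (rule integral_eq_zero_AE, use AE_lborel_singleton[of 0] in eventually_elim)
      (auto simp: True indicator_def)
  then show ?thesis
    using True by (simp add: set_lebesgue_integral_def integral_completion)
next
  case False
  then have t: "t > 0" using t by simp
  have "(LINT s:{0..t}|lebesgue. F s) = (LINT s|lborel. indicator {0..t} s *\<^sub>R F s)"
    unfolding set_lebesgue_integral_def by (rule integral_completion) simp
  also have "\<dots> = t *\<^sub>R (LINT u|lborel. indicator {0..t} (t + (- t) * u) *\<^sub>R F (t + (- t) * u))"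
    using t by (subst lborel_integral_real_affine[where c="-t" and t=t]) auto
  also have "\<dots> = (LINT u|lborel. t * (indicator {0..t} (t + (- t) * u) *\<^sub>R F (t + (- t) * u)))"
    by simp
  also have "\<dots> = (LINT u|lborel. indicator {0<..<1} u *\<^sub>R (t * F (t * (1 - u))))"
  proof (rule integral_cong_AE)
    show "AE u in lborel. t * (indicator {0..t} (t + (- t) * u) *\<^sub>R F (t + (- t) * u)) =
        indicator {0<..<1} u *\<^sub>R (t * F (t * (1 - u)))"
      using AE_lborel_singleton[of 0] AE_lborel_singleton[of 1]
    proof eventually_elim
      case (elim u)
      have "t + (- t) * u \<in> {0..t} \<longleftrightarrow> u \<in> {0<..<1}"
        using t elim mult_le_cancel_left1[of t u] by (auto simp: zero_le_mult_iff)
      then show ?case by (simp add: indicator_def algebra_simps)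
    qed
  qed simp_all
  finally show ?thesis by (simp only: set_lebesgue_integral_def)
qed

section \<open>A Volterra equation\<close>

lemma bounded_by_dist:
  fixes f g :: "real \<Rightarrow>\<^sub>C real"
  shows "\<bar>apply_bcontfun f t - apply_bcontfun g t\<bar> \<le> dist f g"
  using dist_bounded[of f t g] by (simp add: dist_real_def)

text \<open>The exponential weight makes the Volterra operator a contraction for all times at once. The
  absolute value extends it to the whole line, the domain of bounded continuous functions.\<close>
lemma volterra_solution:
  fixes c :: real
  assumes c: "0 \<le> c" "c \<le> 1"
  obtains h where "continuous_on UNIV h"
    "\<And>t. t \<ge> 0 \<Longrightarrow> h t = - 1 - (LINT u:{0<..<1}|lborel. (t + c * sqrt t / sqrt u) * h (t * (1 - u)))"
proof -
  \<comment> \<open>This is the kernel seen by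
    \<open>f t = exp (- 100 * \<bar>t\<bar>) * h t\<close>: the times \<open>t\<close> and
    \<open>t * (1 - u)\<close> differ by \<open>t * u\<close>, which leaves the factor
    \<open>exp (- 100 * \<bar>t\<bar> * u)\<close>.\<close>
  define K where "K t u = (\<bar>t\<bar> + c * sqrt \<bar>t\<bar> / sqrt u) * exp (- 100 * \<bar>t\<bar> * u)" for t u :: real
  \<comment> \<open>A majorant of \<open>K\<close> with an elementary antiderivative
    \<open>P\<close>: in the singular part only, \<open>exp (- z)\<close> is replaced by
    \<open>1 / (1 + z)\<close>, which integrates to an arctangent.\<close>
  define G where "G t u = \<bar>t\<bar> * exp (- 100 * \<bar>t\<bar> * u) + c * (sqrt \<bar>t\<bar> / sqrt u / (1 + 100 * \<bar>t\<bar> * u))" for t u :: real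
  have [measurable]: "K t \<in> borel_measurable borel" "G t \<in> borel_measurable borel" for t
    unfolding K_def[abs_def] G_def[abs_def] by measurable
  have K0: "0 \<le> K t u" if "u \<in> {0<..<1}" for t u
    using that c by (simp add: K_def)
  have KG: "K t u \<le> G t u" if "u \<in> {0<..<1}" for t u
  proof -
    have "0 \<le> 100 * \<bar>t\<bar> * u" using that by simp
    then have "exp (- 100 * \<bar>t\<bar> * u) \<le> 1 / (1 + 100 * \<bar>t\<bar> * u)"
      using exp_ge_add_one_self[of "100 * \<bar>t\<bar> * u"] by (simp add: exp_minus field_simps)
    then have "c * sqrt \<bar>t\<bar> / sqrt u * exp (- 100 * \<bar>t\<bar> * u) \<le> c * sqrt \<bar>t\<bar> / sqrt u * (1 / (1 + 100 * \<bar>t\<bar> * u))"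
      using that c by (intro mult_left_mono) auto
    then show ?thesis by (simp add: K_def G_def distrib_right)
  qed
  have G: "set_integrable lborel {0<..<1} (G t)" "(LINT u:{0<..<1}|lborel. G t u) \<le> 1 / 2" for t
  proof -
    define a where "a = \<bar>t\<bar>"
    have a: "a \<ge> 0" by (simp add: a_def)
    define P where "P u = - exp (- 100 * a * u) / 100 + c / 5 * arctan (10 * sqrt a * sqrt u)" for u
    have "(G t has_integral P 1 - P 0) {0..1}"
    proof (rule fundamental_theorem_of_calculus_interior)
      show "continuous_on {0..1} P" unfolding P_def by (intro continuous_intros) auto
      fix u :: real assume u: "u \<in> {0<..<1}"
      have sq: "(10 * sqrt a * sqrt u)\<^sup>2 = 100 * a * u"
        using u a by (simp add: power_mult_distrib)
      have "c / 5 * (inverse X * (10 * A * (inverse S / 2))) = c * (A / S / X)" for A S X :: real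
        by (simp add: inverse_eq_divide)
      then have 1: "c / 5 * (inverse (1 + (10 * sqrt a * sqrt u)\<^sup>2) * (10 * sqrt a * (inverse (sqrt u) / 2)))
          = c * (sqrt a / sqrt u / (1 + 100 * a * u))"
        unfolding sq .
      have "((\<lambda>u. arctan (10 * sqrt a * sqrt u)) has_real_derivative
          inverse (1 + (10 * sqrt a * sqrt u)\<^sup>2) * (10 * sqrt a * (inverse (sqrt u) / 2))) (at u)"
        by (rule DERIV_chain2[OF DERIV_arctan DERIV_cmult[OF DERIV_real_sqrt]]) (use u in simp)
      from DERIV_cmult[OF this, of "c / 5"]
      have 2: "((\<lambda>u. c / 5 * arctan (10 * sqrt a * sqrt u)) has_real_derivative
          c * (sqrt a / sqrt u / (1 + 100 * a * u))) (at u)" unfolding 1 .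
      have "((\<lambda>u. - exp (- 100 * a * u) / 100) has_real_derivative
          - (exp (- 100 * a * u) * (- 100 * a * 1)) / 100) (at u)"
        by (rule DERIV_cdivide, rule DERIV_minus, rule DERIV_chain2[OF DERIV_exp], rule DERIV_cmult, rule DERIV_ident)
      also have "- (exp (- 100 * a * u) * (- 100 * a * 1)) / 100 = a * exp (- 100 * a * u)"
        by simp
      finally have 3: "((\<lambda>u. - exp (- 100 * a * u) / 100) has_real_derivative a * exp (- 100 * a * u)) (at u)" .
      show "(P has_vector_derivative G t u) (at u)"
        unfolding has_real_derivative_iff_has_vector_derivative[symmetric] P_def[abs_def] G_def
          a_def[symmetric] by (rule DERIV_add[OF 3 2])
    qed simp
    moreover have "0 \<le> G t u" if "0 < u" "u < 1" for u
      using KG[of u t] K0[of u t] that by simp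
    ultimately have *: "set_integrable lborel {0<..<1} (G t)" "(LINT u:{0<..<1}|lborel. G t u) = P 1 - P 0"
      using set_integral_eq_has_integral[of "G t" "P 1 - P 0" 0 1] by auto
    show "set_integrable lborel {0<..<1} (G t)" by fact
    \<comment> \<open>Since \<open>arctan\<close> stays below \<open>pi / 2 < 4 / 2\<close>, the
      total mass is at most 1/100 + 2/5, whatever \<open>t\<close> is. The weight 100 is large
      enough to bring it below 1/2, the contraction constant.\<close>
    have "c / 5 * arctan (10 * sqrt a) \<le> 1 / 5 * (4 / 2)"
      using c arctan_ubound[of "10 * sqrt a"] pi_less_4 a by (intro mult_mono divide_right_mono) auto
    moreover have "P 1 - P 0 \<le> 1 / 100 + c / 5 * arctan (10 * sqrt a)"
      by (simp add: P_def)
    ultimately show "(LINT u:{0<..<1}|lborel. G t u) \<le> 1 / 2"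
      unfolding * by simp
  qed
  have intK: "set_integrable lborel {0<..<1} (\<lambda>u. K t u * f (t * (1 - u)))"
    if "continuous_on UNIV f" "\<And>t. \<bar>f t\<bar> \<le> M" for t f and M :: real
  proof (rule set_integrable_dominated)
    have "0 \<le> M" using that(2)[of 0] by simp
    show "set_integrable lborel {0<..<1} (\<lambda>u. G t u * M)"
      using G(1) by (rule set_integrable_mult_left)
    have [measurable]: "f \<in> borel_measurable borel"
      using that(1) by (rule borel_measurable_continuous_onI)
    show "(\<lambda>u. K t u * f (t * (1 - u))) \<in> borel_measurable borel" by measurable
    show "\<bar>K t u * f (t * (1 - u))\<bar> \<le> G t u * M" if "u \<in> {0<..<1}" for u
      unfolding abs_mult using that K0[OF that, of t] KG[OF that, of t] \<open>0 \<le> M\<close>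
      by (intro mult_mono) (auto simp: \<open>\<And>t. \<bar>f t\<bar> \<le> M\<close>)
  qed simp
  have bound: "\<bar>LINT u:{0<..<1}|lborel. K t u * f (t * (1 - u))\<bar> \<le> M / 2"
    if "\<And>t. \<bar>f t\<bar> \<le> M" for t f and M :: real
  proof -
    have "0 \<le> M" using that[of 0] by simp
    have "\<bar>LINT u:{0<..<1}|lborel. K t u * f (t * (1 - u))\<bar> \<le> (LINT u:{0<..<1}|lborel. G t u * M)"
    proof (rule abs_set_integral_le)
      show "set_integrable lborel {0<..<1} (\<lambda>u. G t u * M)"
        using G(1) by (rule set_integrable_mult_left)
      show "\<bar>K t u * f (t * (1 - u))\<bar> \<le> G t u * M" if "u \<in> {0<..<1}" for u
        unfolding abs_mult using that K0[OF that, of t] KG[OF that, of t] \<open>0 \<le> M\<close>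
        by (intro mult_mono) (auto simp: \<open>\<And>t. \<bar>f t\<bar> \<le> M\<close>)
    qed simp
    also have "\<dots> = (LINT u:{0<..<1}|lborel. G t u) * M" by simp
    also have "\<dots> \<le> 1 / 2 * M" using G(2) \<open>0 \<le> M\<close> by (rule mult_right_mono)
    finally show ?thesis by simp
  qed
  \<comment> \<open>The Volterra operator in weighted form; for \<open>t \<ge> 0\<close> its fixed
    points are the functions \<open>exp (- 100 * t) * h t\<close>.\<close>
  define F where "F f t = - exp (- 100 * \<bar>t\<bar>) - (LINT u:{0<..<1}|lborel. K t u * f (t * (1 - u)))" for f and t :: real
  have F_bcontfun: "F (apply_bcontfun f) \<in> bcontfun" for f
  proof (rule bcontfun_normI)
    define M where "M = norm f"
    have M: "\<bar>apply_bcontfun f t\<bar> \<le> M" for t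
      using norm_bounded[of f t] by (simp add: M_def)
    have "0 \<le> M" by (simp add: M_def)
    have [measurable]: "apply_bcontfun f \<in> borel_measurable borel"
      by (intro borel_measurable_continuous_onI continuous_on_apply_bcontfun)
    have comp: "continuous_on A (\<lambda>x. apply_bcontfun f (g x))" if "continuous_on A g" for A and g :: "real \<Rightarrow> real"
      by (rule continuous_on_compose2[OF continuous_on_apply_bcontfun[of UNIV f] that]) simp
    have "continuous_on UNIV (\<lambda>t. LINT u:{0<..<1}|lborel. K t u * apply_bcontfun f (t * (1 - u)))"
    proof (rule continuous_on_set_integral_dominated)
      show "continuous_on UNIV (\<lambda>t. K t u * apply_bcontfun f (t * (1 - u)))" if "u \<in> {0<..<1}" for u
        unfolding K_def using that by (intro continuous_intros comp) auto
      fix p :: real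
      show "\<exists>g. set_integrable lborel {0<..<1} g \<and> (\<forall>q\<in>UNIV. dist q p < 1 \<longrightarrow>
          (\<forall>u\<in>{0<..<1}. \<bar>K q u * apply_bcontfun f (q * (1 - u))\<bar> \<le> g u))"
      proof (intro exI conjI ballI impI)
        show "set_integrable lborel {0<..<1} (\<lambda>u. (\<bar>p\<bar> + 1 + c * sqrt (\<bar>p\<bar> + 1) / sqrt u) * M)"
          by (intro set_integrable_mult_left set_integrable_kernel)
        fix q u :: real assume q: "dist q p < 1" and u: "u \<in> {0<..<1}"
        have q': "\<bar>q\<bar> \<le> \<bar>p\<bar> + 1" using q by (auto simp: dist_real_def)
        have "K q u \<le> (\<bar>p\<bar> + 1 + c * sqrt (\<bar>p\<bar> + 1) / sqrt u) * 1"
          unfolding K_def using q' u c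
          by (intro mult_mono add_mono divide_right_mono mult_left_mono) auto
        then show "\<bar>K q u * apply_bcontfun f (q * (1 - u))\<bar> \<le> (\<bar>p\<bar> + 1 + c * sqrt (\<bar>p\<bar> + 1) / sqrt u) * M"
          unfolding abs_mult using K0[OF u, of q] M c u
          by (intro mult_mono) auto
      qed
    qed measurable
    then show "continuous_on UNIV (F (apply_bcontfun f))"
      unfolding F_def by (intro continuous_intros)
    show "norm (F (apply_bcontfun f) t) \<le> 1 + M / 2" for t
    proof -
      have "0 \<le> exp (- 100 * \<bar>t\<bar>)" "exp (- 100 * \<bar>t\<bar>) \<le> 1" by simp_all
      then show ?thesis
        using bound[of "apply_bcontfun f" M t, OF M] unfolding F_def real_norm_def by linarith
    qed
  qed
  define \<Psi> where "\<Psi> f = Bcontfun (F (apply_bcontfun f))" for f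
  have \<Psi>: "apply_bcontfun (\<Psi> f) = F (apply_bcontfun f)" for f
    unfolding \<Psi>_def by (rule Bcontfun_inverse[OF F_bcontfun])
  have "dist (\<Psi> f) (\<Psi> g) \<le> 1 / 2 * dist f g" for f g
  proof (rule dist_bound)
    fix t
    have int: "set_integrable lborel {0<..<1} (\<lambda>u. K t u * apply_bcontfun f (t * (1 - u)))" for f
      by (rule intK[of _ "norm f"]) (use norm_bounded[of f] in auto)
    have "F (apply_bcontfun f) t - F (apply_bcontfun g) t =
      - ((LINT u:{0<..<1}|lborel. K t u * apply_bcontfun f (t * (1 - u)))
        - (LINT u:{0<..<1}|lborel. K t u * apply_bcontfun g (t * (1 - u))))"
      by (simp add: F_def)
    also have "\<dots> = - (LINT u:{0<..<1}|lborel. K t u * (apply_bcontfun f (t * (1 - u)) - apply_bcontfun g (t * (1 - u))))"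
      by (subst set_integral_diff(2)[OF int int, symmetric]) (simp only: right_diff_distrib[of "K t _"])
    finally show "dist (apply_bcontfun (\<Psi> f) t) (apply_bcontfun (\<Psi> g) t) \<le> 1 / 2 * dist f g"
      using bound[of "\<lambda>t. apply_bcontfun f t - apply_bcontfun g t" "dist f g" t] bounded_by_dist[of f _ g]
      by (simp add: \<Psi> dist_real_def)
  qed
  then obtain f where f: "\<Psi> f = f"
    using banach_fix_type[of "1 / 2" \<Psi>] by auto
  define h where "h t = exp (100 * \<bar>t\<bar>) * apply_bcontfun f t" for t
  show ?thesis
  proof (rule that)
    show "continuous_on UNIV h" unfolding h_def by (intro continuous_intros continuous_on_apply_bcontfun)
    fix t :: real assume t: "t \<ge> 0"
    have "apply_bcontfun f t = F (apply_bcontfun f) t" using \<Psi>[of f] by (simp add: f)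
    then have "h t = exp (100 * t) * (- exp (- 100 * t) - (LINT u:{0<..<1}|lborel. K t u * apply_bcontfun f (t * (1 - u))))"
      using t by (simp add: h_def F_def)
    also have "\<dots> = - 1 - (LINT u:{0<..<1}|lborel. exp (100 * t) * (K t u * apply_bcontfun f (t * (1 - u))))"
      by (simp add: right_diff_distrib flip: exp_add)
    also have "(LINT u:{0<..<1}|lborel. exp (100 * t) * (K t u * apply_bcontfun f (t * (1 - u)))) =
      (LINT u:{0<..<1}|lborel. (t + c * sqrt t / sqrt u) * h (t * (1 - u)))"
    proof (rule set_lebesgue_integral_cong)
      show "\<forall>u. u \<in> {0<..<1} \<longrightarrow> exp (100 * t) * (K t u * apply_bcontfun f (t * (1 - u))) =
          (t + c * sqrt t / sqrt u) * h (t * (1 - u))"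
      proof (intro allI impI)
        fix u :: real assume u: "u \<in> {0<..<1}"
        have "exp (100 * t) * exp (- 100 * t * u) = exp (100 * (t * (1 - u)))"
          by (simp add: algebra_simps flip: exp_add)
        moreover have "\<bar>t * (1 - u)\<bar> = t * (1 - u)" using t u by simp
        ultimately show "exp (100 * t) * (K t u * apply_bcontfun f (t * (1 - u))) =
          (t + c * sqrt t / sqrt u) * h (t * (1 - u))"
          using t by (simp add: K_def h_def mult_ac)
      qed
    qed simp
    finally show "h t = - 1 - (LINT u:{0<..<1}|lborel. (t + c * sqrt t / sqrt u) * h (t * (1 - u)))" .
  qed
qed

section \<open>Construction of a solution\<close>

context
  fixes \<epsilon> :: real and h :: "real \<Rightarrow> real"
  assumes \<epsilon>: "\<epsilon> > 0" and cont_h: "continuous_on UNIV h"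
begin

text \<open>The time integral in the formula for \<open>norm x * v\<close> in the overview, after
  the substitution of \<open>set_integral_rescale\<close>.\<close>

definition duhamel :: "real \<Rightarrow> real \<Rightarrow> real" where
  "duhamel y t = (LINT u:{0<..<1}|lborel. t * h (t * (1 - u)) * erf (y / (2 * sqrt (t * u / \<epsilon>))))"

text \<open>The integrand is the \<open>y\<close>-derivative of that of \<open>duhamel\<close>;
  \<open>DERIV_duhamel\<close> justifies the exchange.\<close>

definition duhamel_deriv :: "real \<Rightarrow> real \<Rightarrow> real" where
  "duhamel_deriv y t = (LINT u:{0<..<1}|lborel. t * h (t * (1 - u)) *
     (2 / sqrt pi * exp (- (y / (2 * sqrt (t * u / \<epsilon>)))\<^sup>2) * (1 / (2 * sqrt (t * u / \<epsilon>)))))"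

definition v_sol :: "real ^ 3 \<Rightarrow> real \<Rightarrow> real" where
  "v_sol x t = (norm x - 1 + duhamel (norm x - 1) t) / norm x"

text \<open>Since \<open>q' = h\<close> and \<open>q(0) = 0\<close>, the primitive of
  \<open>h\<close> takes the place of \<open>q\<close>. That it agrees with the exponentially
  weighted memory of the trace is \<open>memory_v_sol\<close>.\<close>

definition w_sol :: "real ^ 3 \<Rightarrow> real \<Rightarrow> real" where
  "w_sol x t = - integral {0..t} h / norm x"

lemma borel_measurable_h [measurable]: "h \<in> borel_measurable borel"
  using cont_h by (rule borel_measurable_continuous_onI)

lemma h_bounded:
  obtains B where "B \<ge> 0" "\<And>s. 0 \<le> s \<Longrightarrow> s \<le> T \<Longrightarrow> \<bar>h s\<bar> \<le> B"
proof -
  have "compact (h ` {0..T})"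
    using cont_h by (intro compact_continuous_image) (auto intro: continuous_on_subset)
  then obtain B where "\<forall>z\<in>h ` {0..T}. norm z \<le> B"
    using compact_imp_bounded bounded_iff by blast
  then show ?thesis by (intro that[of "max B 0"]) force+
qed

lemma integral_h:
  assumes "t \<ge> 0"
  shows "(LINT u:{0<..<1}|lborel. t * h (t * (1 - u))) = integral {0..t} h"
proof -
  have "set_integrable lebesgue {0..t} h"
    using cont_h by (intro absolutely_integrable_continuous_real) (auto intro: continuous_on_subset)
  from set_lebesgue_integral_eq_integral(2)[OF this] show ?thesis
    using set_integral_rescale[OF assms, of h] by simp
qed

lemma DERIV_integral_h:
  "s \<in> {0..t} \<Longrightarrow> ((\<lambda>t. integral {0..t} h) has_real_derivative h s) (at s within {0..t})"
  using cont_h by (intro integral_has_real_derivative) (auto intro: continuous_on_subset)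

lemma continuous_on_integral_h: "continuous_on {0<..} (\<lambda>t. integral {0..t} h)"
proof (rule continuous_at_imp_continuous_on, rule ballI)
  fix s :: real assume "s \<in> {0<..}"
  then have "s \<in> {0<..<s + 1}" by simp
  moreover have "((\<lambda>t. integral {0..t} h) has_real_derivative h s) (at s within {0<..<s + 1})"
    by (rule DERIV_subset[OF DERIV_integral_h[of s "s + 1"]]) (use \<open>s \<in> {0<..}\<close> in auto)
  ultimately show "isCont (\<lambda>t. integral {0..t} h) s"
    by (metis DERIV_isCont at_within_open open_greaterThanLessThan)
qed

text \<open>This is the origin of the coefficient \<open>sqrt (\<epsilon> / pi)\<close> in the
  Volterra equation: the left side is \<open>t\<close> times the slope at \<open>y = 0\<close> of
  \<open>erf (y / (2 * sqrt (t * u / \<epsilon>)))\<close>.\<close>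

lemma duhamel_kernel:
  assumes "0 \<le> t" "u \<in> {0<..<1}"
  shows "t * (2 / sqrt pi * (1 / (2 * sqrt (t * u / \<epsilon>)))) = sqrt (\<epsilon> / pi) * sqrt t / sqrt u"
proof (cases "t = 0")
  case False
  then have "t > 0" using assms by simp
  then obtain k where k: "k > 0" "t = k\<^sup>2"
    by (metis real_sqrt_gt_zero real_sqrt_pow2 less_imp_le)
  then show ?thesis
    using assms \<epsilon> by (simp add: real_sqrt_divide real_sqrt_mult power2_eq_square)
qed simp

lemma duhamel_kernel_le:
  assumes "0 \<le> t" "t \<le> T" "u \<in> {0<..<1}"
  shows "t * (2 / sqrt pi * (1 / (2 * sqrt (t * u / \<epsilon>)))) \<le> sqrt (\<epsilon> * T) * (1 / sqrt u)"
proof -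
  have "sqrt (\<epsilon> / pi) * sqrt t \<le> sqrt (\<epsilon> / 1) * sqrt T"
    using assms \<epsilon> pi_ge_two by (intro mult_mono real_sqrt_le_mono divide_left_mono) auto
  then have "sqrt (\<epsilon> / pi) * sqrt t / sqrt u \<le> sqrt \<epsilon> * sqrt T / sqrt u"
    using assms by (intro divide_right_mono) auto
  then show ?thesis
    unfolding duhamel_kernel[OF assms(1,3)] by (simp add: real_sqrt_mult)
qed

section \<open>Bounds on a bounded time interval\<close>

context
  fixes T B :: real
  assumes B: "B \<ge> 0" "\<And>s. 0 \<le> s \<Longrightarrow> s \<le> T \<Longrightarrow> \<bar>h s\<bar> \<le> B"
begin

lemma abs_h_rescaled_le:
  assumes t: "0 \<le> t" "t \<le> T" and u: "u \<in> {0<..<1}"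
  shows "\<bar>h (t * (1 - u))\<bar> \<le> B"
proof -
  have "t * (1 - u) \<le> t * 1" using t u by (intro mult_left_mono) auto
  then show ?thesis using t u by (intro B(2)) auto
qed

lemma abs_duhamel_deriv_integrand_le:
  assumes t: "0 \<le> t" "t \<le> T" and u: "u \<in> {0<..<1}"
  shows "\<bar>t * h (t * (1 - u)) * (2 / sqrt pi * exp (- (y / (2 * sqrt (t * u / \<epsilon>)))\<^sup>2) *
     (1 / (2 * sqrt (t * u / \<epsilon>))))\<bar> \<le> B * sqrt (\<epsilon> * T) * (1 / sqrt u)" (is "?L \<le> _")
proof -
  let ?\<kappa> = "t * (2 / sqrt pi * (1 / (2 * sqrt (t * u / \<epsilon>))))"
  let ?e = "exp (- (y / (2 * sqrt (t * u / \<epsilon>)))\<^sup>2)"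
  have \<kappa>: "?\<kappa> \<ge> 0" using t u \<epsilon> by simp
  have "?L = \<bar>(h (t * (1 - u)) * ?e) * ?\<kappa>\<bar>" by (simp only: mult_ac)
  also have "\<dots> = (\<bar>h (t * (1 - u))\<bar> * ?e) * ?\<kappa>"
    unfolding abs_mult[of _ "?\<kappa>"] abs_mult[of _ "?e"] abs_exp_cancel abs_of_nonneg[OF \<kappa>] ..
  also have "\<dots> \<le> (B * 1) * (sqrt (\<epsilon> * T) * (1 / sqrt u))"
    by (rule mult_mono[OF mult_mono[OF abs_h_rescaled_le[OF t u] _ B(1)] duhamel_kernel_le[OF t u] _ \<kappa>])
      (use B in auto)
  finally show ?thesis by simp
qed

lemma abs_duhamel_integrand_le:
  assumes t: "0 \<le> t" "t \<le> T" and u: "u \<in> {0<..<1}"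
  shows "\<bar>t * h (t * (1 - u)) * erf (y / (2 * sqrt (t * u / \<epsilon>)))\<bar> \<le> \<bar>y\<bar> * (B * sqrt (\<epsilon> * T)) * (1 / sqrt u)"
proof -
  let ?\<kappa> = "t * (2 / sqrt pi * (1 / (2 * sqrt (t * u / \<epsilon>))))"
  have \<kappa>: "?\<kappa> \<ge> 0" using t u \<epsilon> by simp
  have "\<bar>t * h (t * (1 - u)) * erf (y / (2 * sqrt (t * u / \<epsilon>)))\<bar>
      \<le> t * \<bar>h (t * (1 - u))\<bar> * (2 / sqrt pi * \<bar>y / (2 * sqrt (t * u / \<epsilon>))\<bar>)"
    unfolding abs_mult using t by (intro mult_mono abs_erf_le) auto
  also have "\<dots> = \<bar>y\<bar> * (\<bar>h (t * (1 - u))\<bar> * ?\<kappa>)"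
    using t u \<epsilon> by (simp add: abs_mult)
  also have "\<dots> \<le> \<bar>y\<bar> * (B * (sqrt (\<epsilon> * T) * (1 / sqrt u)))"
    by (rule mult_left_mono[OF mult_mono[OF abs_h_rescaled_le[OF t u] duhamel_kernel_le[OF t u] B(1) \<kappa>]]) simp
  finally show ?thesis by (simp add: mult_ac)
qed

lemma abs_duhamel_deriv_le:
  assumes t: "0 \<le> t" "t \<le> T"
  shows "\<bar>duhamel_deriv y t\<bar> \<le> 2 * (B * sqrt (\<epsilon> * T))"
proof -
  have "\<bar>duhamel_deriv y t\<bar> \<le> (LINT u:{0<..<1}|lborel. B * sqrt (\<epsilon> * T) * (1 / sqrt u))"
    unfolding duhamel_deriv_def
    by (rule abs_set_integral_le[OF set_integrable_scaled_inverse_sqrt _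
      abs_duhamel_deriv_integrand_le[OF t]]) simp_all
  then show ?thesis by (simp only: integral_scaled_inverse_sqrt)
qed

text \<open>Growth linear in \<open>y\<close> is harmless because \<open>v_sol\<close> divides by
  \<open>norm x\<close>.\<close>

lemma abs_duhamel_sol_le:
  assumes t: "0 \<le> t" "t \<le> T"
  shows "\<bar>duhamel y t\<bar> \<le> 2 * (\<bar>y\<bar> * (B * sqrt (\<epsilon> * T)))"
proof -
  have "\<bar>duhamel y t\<bar> \<le> (LINT u:{0<..<1}|lborel. \<bar>y\<bar> * (B * sqrt (\<epsilon> * T)) * (1 / sqrt u))"
    unfolding duhamel_def
    by (rule abs_set_integral_le[OF set_integrable_scaled_inverse_sqrt _
      abs_duhamel_integrand_le[OF t]]) simp_all
  then show ?thesis by (simp only: integral_scaled_inverse_sqrt)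
qed

lemma abs_integral_h_le:
  assumes t: "0 \<le> t" "t \<le> T"
  shows "\<bar>integral {0..t} h\<bar> \<le> B * T"
proof -
  have "norm (integral {0..t} h) \<le> B * (t - 0)"
    using B t cont_h by (intro integral_bound) (auto intro: continuous_on_subset)
  also have "\<dots> \<le> B * T" using t B by (intro mult_left_mono) auto
  finally show ?thesis by simp
qed

end

section \<open>Regularity of the Duhamel term and the normal derivative of
  \<open>v_sol\<close>\<close>

lemma DERIV_duhamel:
  assumes t: "t \<ge> 0"
  shows "((\<lambda>y. duhamel y t) has_real_derivative duhamel_deriv y t) (at y)"
proof -
  obtain B where B: "B \<ge> 0" "\<And>s. 0 \<le> s \<Longrightarrow> s \<le> t \<Longrightarrow> \<bar>h s\<bar> \<le> B"
    using h_bounded by blast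
  show ?thesis
    unfolding duhamel_def duhamel_deriv_def
  proof (rule has_real_derivative_set_integral)
    show "set_integrable lborel {0<..<1} (\<lambda>u. B * sqrt (\<epsilon> * t) * (1 / sqrt u))"
      by (intro set_integrable_scaled_inverse_sqrt)
    show "set_integrable lborel {0<..<1} (\<lambda>u. t * h (t * (1 - u)) * erf (y / (2 * sqrt (t * u / \<epsilon>))))" for y
      by (rule set_integrable_dominated[OF set_integrable_scaled_inverse_sqrt _ _
        abs_duhamel_integrand_le[OF B t order_refl]]) simp_all
    show "((\<lambda>y. t * h (t * (1 - u)) * erf (y / (2 * sqrt (t * u / \<epsilon>)))) has_real_derivative
        t * h (t * (1 - u)) * (2 / sqrt pi * exp (- (y / (2 * sqrt (t * u / \<epsilon>)))\<^sup>2) *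
        (1 / (2 * sqrt (t * u / \<epsilon>))))) (at y)" for y u
      by (rule DERIV_cmult, rule DERIV_chain2[OF DERIV_erf], rule DERIV_cdivide, rule DERIV_ident)
  qed (use abs_duhamel_deriv_integrand_le[OF B t order_refl] in auto)
qed

lemma duhamel_0 [simp]: "duhamel 0 t = 0"
  by (simp add: duhamel_def)

lemma snd_bound:
  fixes p q :: "real \<times> real"
  assumes "q \<in> UNIV \<times> {0<..}" "dist q p < 1"
  shows "\<bar>fst q\<bar> \<le> \<bar>fst p\<bar> + 1" "0 \<le> snd q" "snd q \<le> snd p + 1"
  using assms dist_fst_le[of q p] dist_snd_le[of q p] by (auto simp: dist_real_def)

lemma continuous_on_h: "continuous_on S g \<Longrightarrow> continuous_on S (\<lambda>x. h (g x))"
  using continuous_on_compose2[OF cont_h] by blast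

lemma continuous_on_duhamel: "continuous_on (UNIV \<times> {0<..}) (\<lambda>p. duhamel (fst p) (snd p))"
  unfolding duhamel_def
proof (rule continuous_on_set_integral_dominated)
  show "continuous_on (UNIV \<times> {0<..})
      (\<lambda>p. snd p * h (snd p * (1 - u)) * erf (fst p / (2 * sqrt (snd p * u / \<epsilon>))))"
    if "u \<in> {0<..<1}" for u
    using that \<epsilon> by (intro continuous_intros continuous_on_h) auto
  fix p :: "real \<times> real" assume p: "p \<in> UNIV \<times> {0<..}"
  obtain B where B: "B \<ge> 0" "\<And>s. 0 \<le> s \<Longrightarrow> s \<le> snd p + 1 \<Longrightarrow> \<bar>h s\<bar> \<le> B"
    using h_bounded by blast
  show "\<exists>g. set_integrable lborel {0<..<1} g \<and> (\<forall>q\<in>UNIV \<times> {0<..}. dist q p < 1 \<longrightarrow>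
    (\<forall>u\<in>{0<..<1}. \<bar>snd q * h (snd q * (1 - u)) * erf (fst q / (2 * sqrt (snd q * u / \<epsilon>)))\<bar> \<le> g u))"
  proof (intro exI conjI ballI impI)
    show "set_integrable lborel {0<..<1}
        (\<lambda>u. (\<bar>fst p\<bar> + 1) * (B * sqrt (\<epsilon> * (snd p + 1))) * (1 / sqrt u))"
      by (intro set_integrable_scaled_inverse_sqrt)
    fix q :: "real \<times> real" and u :: real
    assume q: "q \<in> UNIV \<times> {0<..}" "dist q p < 1" and u: "u \<in> {0<..<1}"
    note * = snd_bound[OF q]
    have "\<bar>snd q * h (snd q * (1 - u)) * erf (fst q / (2 * sqrt (snd q * u / \<epsilon>)))\<bar>
      \<le> \<bar>fst q\<bar> * (B * sqrt (\<epsilon> * (snd p + 1))) * (1 / sqrt u)"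
      by (rule abs_duhamel_integrand_le[OF B *(2,3) u])
    also have "\<dots> \<le> (\<bar>fst p\<bar> + 1) * (B * sqrt (\<epsilon> * (snd p + 1))) * (1 / sqrt u)"
      using * u B p \<epsilon> by (intro mult_right_mono) auto
    finally show "\<bar>snd q * h (snd q * (1 - u)) * erf (fst q / (2 * sqrt (snd q * u / \<epsilon>)))\<bar> \<le>
      (\<bar>fst p\<bar> + 1) * (B * sqrt (\<epsilon> * (snd p + 1))) * (1 / sqrt u)" .
  qed
qed measurable

lemma continuous_on_duhamel_deriv:
  "continuous_on (UNIV \<times> {0<..}) (\<lambda>p. duhamel_deriv (fst p) (snd p))"
  unfolding duhamel_deriv_def
proof (rule continuous_on_set_integral_dominated)
  show "continuous_on (UNIV \<times> {0<..})
      (\<lambda>p. snd p * h (snd p * (1 - u)) * (2 / sqrt pi * exp (- (fst p / (2 * sqrt (snd p * u / \<epsilon>)))\<^sup>2) *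
        (1 / (2 * sqrt (snd p * u / \<epsilon>)))))"
    if "u \<in> {0<..<1}" for u
    using that \<epsilon> by (intro continuous_intros continuous_on_h) auto
  fix p :: "real \<times> real" assume p: "p \<in> UNIV \<times> {0<..}"
  obtain B where B: "B \<ge> 0" "\<And>s. 0 \<le> s \<Longrightarrow> s \<le> snd p + 1 \<Longrightarrow> \<bar>h s\<bar> \<le> B"
    using h_bounded by blast
  show "\<exists>g. set_integrable lborel {0<..<1} g \<and> (\<forall>q\<in>UNIV \<times> {0<..}. dist q p < 1 \<longrightarrow>
    (\<forall>u\<in>{0<..<1}. \<bar>snd q * h (snd q * (1 - u)) * (2 / sqrt pi *
      exp (- (fst q / (2 * sqrt (snd q * u / \<epsilon>)))\<^sup>2) * (1 / (2 * sqrt (snd q * u / \<epsilon>))))\<bar> \<le> g u))"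
  proof (intro exI conjI ballI impI)
    show "set_integrable lborel {0<..<1} (\<lambda>u. B * sqrt (\<epsilon> * (snd p + 1)) * (1 / sqrt u))"
      by (intro set_integrable_scaled_inverse_sqrt)
    fix q :: "real \<times> real" and u :: real
    assume q: "q \<in> UNIV \<times> {0<..}" "dist q p < 1" and u: "u \<in> {0<..<1}"
    show "\<bar>snd q * h (snd q * (1 - u)) * (2 / sqrt pi *
      exp (- (fst q / (2 * sqrt (snd q * u / \<epsilon>)))\<^sup>2) * (1 / (2 * sqrt (snd q * u / \<epsilon>))))\<bar>
      \<le> B * sqrt (\<epsilon> * (snd p + 1)) * (1 / sqrt u)"
      by (rule abs_duhamel_deriv_integrand_le[OF B snd_bound(2,3)[OF q] u])
  qed
qed measurable

lemma has_vector_derivative_v_sol: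
  assumes x: "x \<in> Omega" and t: "t \<ge> 0"
  shows "((\<lambda>\<rho>. v_sol (\<rho> *\<^sub>R sgn x) t) has_vector_derivative
    ((1 + duhamel_deriv (norm x - 1) t) * norm x - (norm x - 1 + duhamel (norm x - 1) t) * 1) / (norm x * norm x))
    (at (norm x) within {1..})"
proof (rule has_vector_derivative_transform)
  have x1: "norm x \<ge> 1" using x by (auto simp: Omega_def)
  show "norm x \<in> {1..}" using x1 by simp
  show "v_sol (\<rho> *\<^sub>R sgn x) t = (\<rho> - 1 + duhamel (\<rho> - 1) t) / \<rho>" if "\<rho> \<in> {1..}" for \<rho>
  proof -
    have "norm (\<rho> *\<^sub>R sgn x) = \<rho>" using x1 that by (auto simp: norm_sgn)
    then show ?thesis by (simp only: v_sol_def)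
  qed
  \<comment> \<open>The derivative of \<open>duhamel\<close> exists for every real \<open>y\<close>,
    so it is two-sided even at \<open>norm x = 1\<close>; restriction to \<open>{1..}\<close> comes
    last.\<close>
  have J: "((\<lambda>\<rho>. duhamel (\<rho> - 1) t) has_real_derivative duhamel_deriv (norm x - 1) t * 1) (at (norm x))"
    by (rule DERIV_chain2[OF DERIV_duhamel[OF t]]) (auto intro!: derivative_eq_intros)
  have "((\<lambda>\<rho>. (\<rho> - 1 + duhamel (\<rho> - 1) t) / \<rho>) has_real_derivative
    ((1 + duhamel_deriv (norm x - 1) t) * norm x - (norm x - 1 + duhamel (norm x - 1) t) * 1) / (norm x * norm x))
    (at (norm x))"
  proof (rule DERIV_divide)
    show "((\<lambda>\<rho>. \<rho> - 1 + duhamel (\<rho> - 1) t) has_real_derivative 1 + duhamel_deriv (norm x - 1) t) (at (norm x))"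
      by (rule DERIV_add) (use J in \<open>auto intro!: derivative_eq_intros\<close>)
  qed (use x1 in auto)
  then show "((\<lambda>\<rho>. (\<rho> - 1 + duhamel (\<rho> - 1) t) / \<rho>) has_vector_derivative
    ((1 + duhamel_deriv (norm x - 1) t) * norm x - (norm x - 1 + duhamel (norm x - 1) t) * 1) / (norm x * norm x))
    (at (norm x) within {1..})"
    unfolding has_real_derivative_iff_has_vector_derivative[symmetric] by (rule has_field_derivative_at_within)
qed

lemma normal_deriv_v_sol:
  assumes x: "x \<in> Omega" and t: "t \<ge> 0"
  shows "normal_deriv (\<lambda>x. v_sol x t) x = (norm x - 1 + duhamel (norm x - 1) t) / (norm x)\<^sup>2
    - (1 + duhamel_deriv (norm x - 1) t) / norm x"
proof -
  have x1: "norm x \<ge> 1" "x \<noteq> 0" using x by (auto simp: Omega_def)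
  show ?thesis
    unfolding normal_deriv_def
      vector_derivative_within[OF at_within_atLeast_neq_bot[OF x1(1)] has_vector_derivative_v_sol[OF x t]]
    using x1 by (simp add: diff_divide_distrib power2_eq_square)
qed

lemma normal_differentiable_v_sol:
  "x \<in> Omega \<Longrightarrow> t \<ge> 0 \<Longrightarrow> normal_differentiable (\<lambda>x. v_sol x t) x"
  unfolding normal_differentiable_def
  using has_vector_derivative_v_sol differentiableI_vector by blast

section \<open>The integral equations recovered from the Volterra equation\<close>

context
  assumes h: "\<And>t. t \<ge> 0 \<Longrightarrow>
    h t = - 1 - (LINT u:{0<..<1}|lborel. (t + sqrt (\<epsilon> / pi) * sqrt t / sqrt u) * h (t * (1 - u)))"
begin

text \<open>At \<open>norm x = 1\<close> the normal derivative reduces to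
  \<open>- 1 - duhamel_deriv 0 t\<close>. The regular part of the Volterra kernel gives the
  primitive of \<open>h\<close>, and by \<open>duhamel_kernel\<close> the singular part gives
  \<open>duhamel_deriv 0 t\<close>.\<close>

lemma normal_trace_v_sol:
  assumes t: "t \<ge> 0"
  shows "normal_trace v_sol t = h t + integral {0..t} h"
proof -
  obtain B where B: "B \<ge> 0" "\<And>s. 0 \<le> s \<Longrightarrow> s \<le> t \<Longrightarrow> \<bar>h s\<bar> \<le> B"
    using h_bounded by blast
  let ?D = "\<lambda>u. t * h (t * (1 - u)) * (2 / sqrt pi * exp (- (0 / (2 * sqrt (t * u / \<epsilon>)))\<^sup>2) *
        (1 / (2 * sqrt (t * u / \<epsilon>))))"
  have int: "set_integrable lborel {0<..<1} (\<lambda>u. t * h (t * (1 - u)))" "set_integrable lborel {0<..<1} ?D"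
  proof -
    have "set_integrable lborel {0<..<1} (\<lambda>u::real. t * B)"
      using set_integrable_kernel[of "t * B" 0] by simp
    then show "set_integrable lborel {0<..<1} (\<lambda>u. t * h (t * (1 - u)))"
      by (rule set_integrable_dominated)
        (use abs_h_rescaled_le[OF B t order_refl] t in \<open>auto simp: abs_mult intro!: mult_left_mono\<close>)
    show "set_integrable lborel {0<..<1} ?D"
      by (rule set_integrable_dominated[OF set_integrable_scaled_inverse_sqrt _ _
        abs_duhamel_deriv_integrand_le[OF B t order_refl]]) simp_all
  qed
  have "h t = - 1 - (LINT u:{0<..<1}|lborel. (t + sqrt (\<epsilon> / pi) * sqrt t / sqrt u) * h (t * (1 - u)))"
    using h t .
  also have "(LINT u:{0<..<1}|lborel. (t + sqrt (\<epsilon> / pi) * sqrt t / sqrt u) * h (t * (1 - u))) =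
      (LINT u:{0<..<1}|lborel. t * h (t * (1 - u)) + ?D u)"
  proof (rule set_lebesgue_integral_cong)
    show "\<forall>u. u \<in> {0<..<1} \<longrightarrow> (t + sqrt (\<epsilon> / pi) * sqrt t / sqrt u) * h (t * (1 - u)) = t * h (t * (1 - u)) + ?D u"
    proof (intro allI impI)
      fix u :: real assume u: "u \<in> {0<..<1}"
      show "(t + sqrt (\<epsilon> / pi) * sqrt t / sqrt u) * h (t * (1 - u)) = t * h (t * (1 - u)) + ?D u"
        unfolding duhamel_kernel[OF t u, symmetric] by (simp add: distrib_right)
    qed
  qed simp
  also have "\<dots> = integral {0..t} h + duhamel_deriv 0 t"
    unfolding duhamel_deriv_def integral_h[OF t, symmetric] by (rule set_integral_add(2)[OF int])
  finally have "h t + integral {0..t} h = - 1 - duhamel_deriv 0 t" by simp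
  then show ?thesis
    using t by (simp add: normal_trace_def profile_def normal_deriv_v_sol)
qed

text \<open>With \<open>Q\<close> the primitive of \<open>h\<close>, the trace equals
  \<open>Q' + Q\<close>, so the integrand is the derivative of \<open>exp (s - t) * Q s\<close>, and
  \<open>Q\<close> vanishes at 0.\<close>

lemma memory_v_sol:
  assumes t: "t \<ge> 0"
  shows "(LINT s:{0..t}|lebesgue. exp (s - t) * normal_trace v_sol s) = integral {0..t} h"
proof -
  let ?Q = "\<lambda>t. integral {0..t} h"
  let ?f = "\<lambda>s. exp (s - t) * (h s + ?Q s)"
  have "(LINT s:{0..t}|lebesgue. exp (s - t) * normal_trace v_sol s) = (LINT s:{0..t}|lebesgue. ?f s)"
    by (rule set_lebesgue_integral_cong) (auto simp: normal_trace_v_sol)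
  also have "\<dots> = integral {0..t} ?f"
  proof (rule set_lebesgue_integral_eq_integral(2))
    show "set_integrable lebesgue {0..t} ?f"
      using DERIV_continuous_on[OF DERIV_integral_h, of t]
      by (intro absolutely_integrable_continuous_real continuous_intros continuous_on_h) auto
  qed
  also have "(?f has_integral exp (t - t) * ?Q t - exp (0 - t) * ?Q 0) {0..t}"
  proof (rule fundamental_theorem_of_calculus[OF t])
    fix s assume s: "s \<in> {0..t}"
    have "((\<lambda>s. exp (s - t) * ?Q s) has_real_derivative exp (s - t) * ?Q s + h s * exp (s - t)) (at s within {0..t})"
      by (rule DERIV_mult[OF _ DERIV_integral_h[OF s]]) (auto intro!: derivative_eq_intros)
    then show "((\<lambda>s. exp (s - t) * ?Q s) has_vector_derivative ?f s) (at s within {0..t})"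
      by (simp add: has_real_derivative_iff_has_vector_derivative algebra_simps)
  qed
  then have "integral {0..t} ?f = ?Q t"
    by (simp add: integral_unique)
  finally show ?thesis .
qed

lemma flux_v_sol: "t \<ge> 0 \<Longrightarrow> flux v_sol t = h t"
  by (simp add: flux_def normal_trace_v_sol memory_v_sol)

lemma w_equation_sol: "w_equation 0 v_sol w_sol"
  by (simp add: w_equation_zero_iff memory_v_sol w_sol_def)

lemma v_equation_sol: "v_equation \<epsilon> steady 0 v_sol"
  unfolding v_equation_steady_iff[OF \<epsilon>]
proof (intro ballI allI impI)
  fix x :: "real ^ 3" and t :: real assume t: "0 < t"
  let ?y = "norm x - 1"
  have "(LINT s:{0..t}|lebesgue. flux v_sol s * erf (?y / (2 * sqrt ((t - s) / \<epsilon>)))) =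
    (LINT s:{0..t}|lebesgue. h s * erf (?y / (2 * sqrt ((t - s) / \<epsilon>))))"
    by (rule set_lebesgue_integral_cong) (auto simp: flux_v_sol)
  also have "\<dots> = (LINT u:{0<..<1}|lborel. t * (h (t * (1 - u)) * erf (?y / (2 * sqrt ((t - t * (1 - u)) / \<epsilon>)))))"
    using t by (intro set_integral_rescale) auto
  also have "\<dots> = duhamel ?y t"
    unfolding duhamel_def by (simp add: right_diff_distrib mult.assoc)
  finally show "v_sol x t = (?y + (LINT s:{0..t}|lebesgue.
      flux v_sol s * erf (?y / (2 * sqrt ((t - s) / \<epsilon>))))) / norm x"
    by (simp only: v_sol_def)
qed

lemma radial_global_solution_sol: "radial_global_solution \<epsilon> steady 0 v_sol w_sol"
proof -
  let ?S = "Omega \<times> {0::real<..}"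
  let ?g = "\<lambda>x t. normal_deriv (\<lambda>y. v_sol y t) x"
  have nz: "norm x \<noteq> 0" if "x \<in> Omega" for x
    using that by (auto simp: Omega_def)
  have cont_norm: "continuous_on ?S (\<lambda>p. (norm (fst p) - 1, snd p))"
    by (intro continuous_intros)
  have sub: "(\<lambda>p. (norm (fst p) - 1, snd p)) ` ?S \<subseteq> UNIV \<times> {0<..}"
    by auto
  have J: "continuous_on ?S (\<lambda>p. duhamel (norm (fst p) - 1) (snd p))"
    using continuous_on_compose2[OF continuous_on_duhamel cont_norm sub] by simp
  have D: "continuous_on ?S (\<lambda>p. duhamel_deriv (norm (fst p) - 1) (snd p))"
    using continuous_on_compose2[OF continuous_on_duhamel_deriv cont_norm sub] by simp
  have Q: "continuous_on ?S (\<lambda>p. integral {0..snd p} h)"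
    by (rule continuous_on_compose2[OF continuous_on_integral_h, of _ snd]) (auto intro!: continuous_intros)
  have v: "continuous_on ?S (\<lambda>(x, t). v_sol x t)"
    unfolding v_sol_def case_prod_unfold by (intro continuous_intros J) (use nz in auto)
  have w: "continuous_on ?S (\<lambda>(x, t). w_sol x t)"
    unfolding w_sol_def case_prod_unfold by (intro continuous_intros Q) (use nz in auto)
  have "continuous_on ?S (\<lambda>p. (norm (fst p) - 1 + duhamel (norm (fst p) - 1) (snd p)) / (norm (fst p))\<^sup>2
    - (1 + duhamel_deriv (norm (fst p) - 1) (snd p)) / norm (fst p))"
    by (intro continuous_intros J D) (use nz in auto)
  then have g: "continuous_on ?S (\<lambda>(x, t). ?g x t)"
    by (rule continuous_on_eq) (auto simp: normal_deriv_v_sol)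
  have slice: "continuous_on Omega (\<lambda>x. f x t)" if "continuous_on ?S (\<lambda>(x, t). f x t)" "t > 0"
    for f :: "real ^ 3 \<Rightarrow> real \<Rightarrow> real" and t
  proof -
    have "continuous_on Omega (\<lambda>x. (\<lambda>(x, t). f x t) (x, t))"
      by (rule continuous_on_compose2[OF that(1)]) (use that(2) in \<open>auto intro!: continuous_intros\<close>)
    then show ?thesis by simp
  qed
  have "(SUP t\<in>{0<..<T}. Linf_norm (\<lambda>x. v_sol x t) + ennreal (sqrt (t / \<epsilon>)) * Linf_norm (normal_deriv (\<lambda>x. v_sol x t))
        + Linf_norm (\<lambda>x. w_sol x t)) < \<infinity>" for T
  proof -
    obtain B where B: "B \<ge> 0" "\<And>s. 0 \<le> s \<Longrightarrow> s \<le> T \<Longrightarrow> \<bar>h s\<bar> \<le> B"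
      using h_bounded by blast
    \<comment> \<open>One constant for two purposes: it bounds \<open>1 + duhamel_deriv y t\<close>,
      and \<open>C * y\<close> bounds \<open>y + duhamel y t\<close> for \<open>y \<ge> 0\<close>,
      uniformly for \<open>t\<close> in \<open>{0<..<T}\<close>.\<close>
    define C where "C = 1 + 2 * (B * sqrt (\<epsilon> * T))"
    have "(SUP t\<in>{0<..<T}. Linf_norm (\<lambda>x. v_sol x t) + ennreal (sqrt (t / \<epsilon>)) * Linf_norm (normal_deriv (\<lambda>x. v_sol x t))
        + Linf_norm (\<lambda>x. w_sol x t)) \<le> ennreal C + ennreal (sqrt (T / \<epsilon>)) * ennreal (C + C) + ennreal (B * T)"
    proof (rule SUP_least)
      fix t assume "t \<in> {0<..<T}"
      then have t: "0 < t" "0 \<le> t" "t \<le> T" by auto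
      have T: "0 \<le> T" using t by simp
      then have C: "C \<ge> 1" using B \<epsilon> by (simp add: C_def)
      have yJ: "\<bar>norm x - 1 + duhamel (norm x - 1) t\<bar> \<le> C * norm x" if "x \<in> Omega" for x :: "real ^ 3"
      proof -
        have y: "norm x - 1 \<ge> 0" using that by (simp add: Omega_def)
        have "\<bar>norm x - 1 + duhamel (norm x - 1) t\<bar> \<le> C * (norm x - 1)"
          using abs_duhamel_sol_le[OF B t(2,3), of "norm x - 1"] y by (simp add: C_def algebra_simps)
        also have "\<dots> \<le> C * norm x" using C by (intro mult_left_mono) auto
        finally show ?thesis .
      qed
      have "Linf_norm (\<lambda>x. v_sol x t) \<le> ennreal C"
      proof (rule Linf_norm_le[OF slice[OF v t(1)]])
        fix x assume x: "x \<in> Omega"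
        then have "norm x > 0" using nz by force
        then show "\<bar>v_sol x t\<bar> \<le> C"
          using yJ[OF x] by (simp add: v_sol_def divide_le_eq)
      qed
      moreover have "Linf_norm (normal_deriv (\<lambda>x. v_sol x t)) \<le> ennreal (C + C)"
      proof (rule Linf_norm_le)
        show "continuous_on Omega (normal_deriv (\<lambda>x. v_sol x t))" using slice[OF g t(1)] by simp
        fix x assume x: "x \<in> Omega"
        then have r: "norm x \<ge> 1" by (simp add: Omega_def)
        have "\<bar>norm x - 1 + duhamel (norm x - 1) t\<bar> \<le> C * (norm x)\<^sup>2"
        proof -
          have "C * norm x \<le> C * (norm x * norm x)"
            using r C by (intro mult_left_mono) (auto simp: mult_le_cancel_left1)
          then show ?thesis using yJ[OF x] by (simp add: power2_eq_square)
        qed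
        then have 1: "\<bar>(norm x - 1 + duhamel (norm x - 1) t) / (norm x)\<^sup>2\<bar> \<le> C"
          using r C by (simp add: divide_le_eq)
        have "\<bar>1 + duhamel_deriv (norm x - 1) t\<bar> \<le> C"
          using abs_duhamel_deriv_le[OF B t(2,3), of "norm x - 1"] by (simp add: C_def)
        also have "\<dots> \<le> C * norm x" using r C by (simp add: mult_le_cancel_left1)
        finally have 2: "\<bar>(1 + duhamel_deriv (norm x - 1) t) / norm x\<bar> \<le> C"
          using r C by (simp add: divide_le_eq)
        show "\<bar>?g x t\<bar> \<le> C + C"
          unfolding normal_deriv_v_sol[OF x t(2)] using 1 2 by linarith
      qed
      moreover have "Linf_norm (\<lambda>x. w_sol x t) \<le> ennreal (B * T)"
      proof (rule Linf_norm_le[OF slice[OF w t(1)]])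
        fix x assume "x \<in> Omega"
        then have r: "norm x \<ge> 1" by (simp add: Omega_def)
        have "\<bar>integral {0..t} h\<bar> \<le> B * T" by (rule abs_integral_h_le[OF B t(2,3)])
        also have "\<dots> \<le> B * T * norm x"
          using mult_left_mono[OF r, of "B * T"] B(1) T by simp
        finally show "\<bar>w_sol x t\<bar> \<le> B * T"
          using r B(1) T by (simp add: w_sol_def divide_le_eq)
      qed
      moreover have "ennreal (sqrt (t / \<epsilon>)) \<le> ennreal (sqrt (T / \<epsilon>))"
        using t \<epsilon> by (intro ennreal_leI real_sqrt_le_mono divide_right_mono) auto
      ultimately show "Linf_norm (\<lambda>x. v_sol x t) + ennreal (sqrt (t / \<epsilon>)) * Linf_norm (normal_deriv (\<lambda>x. v_sol x t))
        + Linf_norm (\<lambda>x. w_sol x t) \<le> ennreal C + ennreal (sqrt (T / \<epsilon>)) * ennreal (C + C) + ennreal (B * T)"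
        by (intro add_mono mult_mono) auto
    qed
    also have "\<dots> < \<infinity>" by (simp add: ennreal_mult_less_top)
    finally show ?thesis .
  qed
  moreover have "\<forall>t>0. radial (\<lambda>x. v_sol x t) \<and> radial (\<lambda>x. w_sol x t)"
    by (simp add: radial_def v_sol_def w_sol_def)
  ultimately show ?thesis
    using v w g w_equation_sol v_equation_sol normal_differentiable_v_sol
    by (simp add: radial_global_solution_def global_solution_def)
qed

end

end

section \<open>Existence for small \<epsilon> and conclusion\<close>

lemma ex_radial_global_solution:
  assumes "0 < \<epsilon>" "\<epsilon> \<le> 1"
  shows "\<exists>v w. radial_global_solution \<epsilon> steady 0 v w"
proof -
  \<comment> \<open>The Volterra coefficient is \<open>c = sqrt (\<epsilon> / pi)\<close>, and
    \<epsilon> \<le> 1 < \<open>pi\<close>.\<close>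
  have c: "0 \<le> sqrt (\<epsilon> / pi)" "sqrt (\<epsilon> / pi) \<le> 1"
    using assms pi_ge_two by (simp_all add: divide_le_eq)
  obtain h where "continuous_on UNIV h"
    "\<And>t. t \<ge> 0 \<Longrightarrow> h t = - 1 - (LINT u:{0<..<1}|lborel. (t + sqrt (\<epsilon> / pi) * sqrt t / sqrt u) * h (t * (1 - u)))"
    using volterra_solution[OF c] by blast
  from radial_global_solution_sol[OF assms(1) this] show ?thesis by blast
qed

text \<open>The lower bound is established for every solution in the class, and existence is
  asserted beside it so that the bound is not vacuous.\<close>

theorem theorem7:
  shows "\<exists>\<phi> :: real ^ 3 \<Rightarrow> real. \<phi> \<in> Linf \<and> radial \<phi> \<and>
    (\<forall>r>1. \<exists>\<tau>2>0. \<forall>K :: ((real ^ 3) \<times> real) set.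
       compact K \<and> K \<subseteq> (UNIV - ball 0 r) \<times> {0<..<\<tau>2} \<longrightarrow>
       (\<exists>C>0. \<exists>\<epsilon>0. 0 < \<epsilon>0 \<and> \<epsilon>0 \<le> 1 / sqrt pi \<and>
          (\<forall>\<epsilon>. 0 < \<epsilon> \<and> \<epsilon> < \<epsilon>0 \<longrightarrow>
             (\<exists>v w. radial_global_solution \<epsilon> \<phi> 0 v w) \<and>
             (\<forall>v w. radial_global_solution \<epsilon> \<phi> 0 v w \<longrightarrow>
                (\<forall>(x, t)\<in>K.
                   v x t + w x t - S2 t 0 x = v x t + w x t \<and>
                   v x t + w x t \<ge> C * sqrt \<epsilon>)))))"
proof (rule exI[of _ steady], intro conjI allI impI)
  have cont: "continuous_on Omega steady"
    by (intro continuous_intros) (auto simp: Omega_def)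
  have "Linf_norm steady \<le> ennreal 1"
  proof (rule Linf_norm_le[OF cont])
    fix x assume "x \<in> Omega"
    then have "norm x \<ge> 1" by (simp add: Omega_def)
    then have "0 \<le> 1 / norm x" "1 / norm x \<le> 1" by (simp_all add: divide_le_eq)
    then show "\<bar>steady x\<bar> \<le> 1" by linarith
  qed
  also have "\<dots> < \<infinity>" by simp
  finally show "steady \<in> Linf"
    using borel_measurable_Omega[OF cont] by (simp add: Linf_def)
  show "radial steady" by (simp add: radial_def)
  fix r :: real assume r: "r > 1"
  \<comment> \<open>The bound \<open>sqrt t \<le> (r - 1) / 16\<close> yields
    \<open>4 * sqrt t \<le> (r - 1) / 4\<close>, as \<open>solution_lower_bound\<close> requires;
    the minimum with 1 keeps \<open>t\<close> in the range of the a priori estimate.\<close>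
  define \<tau> where "\<tau> = min 1 (((r - 1) / 16)\<^sup>2)"
  show "\<exists>\<tau>2>0. \<forall>K :: ((real ^ 3) \<times> real) set.
       compact K \<and> K \<subseteq> (UNIV - ball 0 r) \<times> {0<..<\<tau>2} \<longrightarrow>
       (\<exists>C>0. \<exists>\<epsilon>0. 0 < \<epsilon>0 \<and> \<epsilon>0 \<le> 1 / sqrt pi \<and>
          (\<forall>\<epsilon>. 0 < \<epsilon> \<and> \<epsilon> < \<epsilon>0 \<longrightarrow>
             (\<exists>v w. radial_global_solution \<epsilon> steady 0 v w) \<and>
             (\<forall>v w. radial_global_solution \<epsilon> steady 0 v w \<longrightarrow>
                (\<forall>(x, t)\<in>K.
                   v x t + w x t - S2 t 0 x = v x t + w x t \<and>
                   v x t + w x t \<ge> C * sqrt \<epsilon>))))"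
  proof (rule exI[of _ \<tau>], intro conjI allI impI)
    show "\<tau> > 0" using r by (simp add: \<tau>_def)
    fix K :: "((real ^ 3) \<times> real) set"
    assume K: "compact K \<and> K \<subseteq> (UNIV - ball 0 r) \<times> {0<..<\<tau>}"
    \<comment> \<open>The constant depends on \<open>r\<close> only and serves every compact
      \<open>K\<close>.\<close>
    define C where "C = (1 - 1 / r) / 4"
    have C: "C > 0" using r by (simp add: C_def)
    \<comment> \<open>From \<open>sqrt pi \<le> 2\<close> it follows that \<open>1 / sqrt pi\<close>
      is at least 1/2, far above the threshold 1/1000 from the a priori estimate.\<close>
    have "sqrt pi \<le> sqrt (2\<^sup>2)" using pi_less_4 by (intro real_sqrt_le_mono) simp
    then have \<epsilon>0: "(1 / 1000 :: real) \<le> 1 / sqrt pi" by (simp add: field_simps)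
    have lower: "v x t + w x t - S2 t 0 x = v x t + w x t \<and> v x t + w x t \<ge> C * sqrt \<epsilon>"
      if \<epsilon>: "0 < \<epsilon>" "\<epsilon> < 1 / 1000" and sol: "radial_global_solution \<epsilon> steady 0 v w" and xt: "(x, t) \<in> K"
      for \<epsilon> v w x t
    proof
      show "v x t + w x t - S2 t 0 x = v x t + w x t" by (simp add: S2_def)
      have x: "norm x \<ge> r" and t: "0 < t" "t < 1" "t \<le> ((r - 1) / 16)\<^sup>2"
        using K xt by (auto simp: \<tau>_def)
      have "sqrt t \<le> (r - 1) / 16" using t(3) r by (intro real_le_lsqrt) auto
      then have "4 * sqrt t \<le> (r - 1) / 4" by simp
      from solution_lower_bound[OF sol \<epsilon> t(1,2) this r x] have "v x t + w x t \<ge> C"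
        by (simp add: C_def)
      \<comment> \<open>The lower bound \<open>C\<close> is independent of \<epsilon>, hence
        stronger than the required \<open>C * sqrt \<epsilon>\<close> for \<epsilon> < 1.\<close>
      moreover have "C * sqrt \<epsilon> \<le> C * 1" using C \<epsilon> by (intro mult_left_mono) auto
      ultimately show "v x t + w x t \<ge> C * sqrt \<epsilon>" by simp
    qed
    show "\<exists>C>0. \<exists>\<epsilon>0. 0 < \<epsilon>0 \<and> \<epsilon>0 \<le> 1 / sqrt pi \<and>
          (\<forall>\<epsilon>. 0 < \<epsilon> \<and> \<epsilon> < \<epsilon>0 \<longrightarrow>
             (\<exists>v w. radial_global_solution \<epsilon> steady 0 v w) \<and>
             (\<forall>v w. radial_global_solution \<epsilon> steady 0 v w \<longrightarrow>
                (\<forall>(x, t)\<in>K.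
                   v x t + w x t - S2 t 0 x = v x t + w x t \<and>
                   v x t + w x t \<ge> C * sqrt \<epsilon>)))"
    proof (rule exI[of _ C], rule conjI[OF C], rule exI[of _ "1 / 1000"], intro conjI allI impI ballI)
      show "(1 / 1000 :: real) \<le> 1 / sqrt pi" by (rule \<epsilon>0)
      fix \<epsilon> :: real assume \<epsilon>: "0 < \<epsilon> \<and> \<epsilon> < 1 / 1000"
      then show "\<exists>v w. radial_global_solution \<epsilon> steady 0 v w"
        by (intro ex_radial_global_solution) auto
      fix v w p assume "radial_global_solution \<epsilon> steady 0 v w" "p \<in> K"
      then show "case p of (x, t) \<Rightarrow> v x t + w x t - S2 t 0 x = v x t + w x t \<and> v x t + w x t \<ge> C * sqrt \<epsilon>"
        using lower[of \<epsilon> v w "fst p" "snd p"] \<epsilon> by (simp only: case_prod_unfold prod.collapse)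
    qed simp
  qed
qed

end
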